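(* Let $\mathbb{G}=(\mathbb{R}^n,\cdot)$ be a Carnot group of step $s\ge2$ with basis $X_1,\dots,X_m$ of its horizontal layer $V_1$. Assume that for some $V=\xi\cdot X\in V_1$, with $\xi\in\mathbb{R}^m$, there is $p\in\mathbb{N}$ such that the differential of the $p$-th multiexponential map $$d\Gamma^{(p)}(\xi,\xi,\dots,\xi):(\mathbb{R}^m)^p\to\mathbb{R}^n$$ is onto. Then the subRiemannian distance from the origin, $x\mapsto d(0,x)$, is Pansu differentiable at $\exp(V)$.
   Context: Carnot group of step $s\ge2$: a Lie group $\mathbb{G}=(\mathbb{R}^n,\cdot)$ with identity $0$, where $\mathbb{R}^n=\mathbb{R}^{m_1}\times\cdots\times\mathbb{R}^{m_s}\ni x=(x^{(1)},\dots,x^{(s)})$, such that for every $\lambda>0$ the dilation $\delta_\lambda(x)=(\lambda x^{(1)},\lambda^2x^{(2)},\dots,\lambda^s x^{(s)})$ is a group automorphism. Put $m=m_1$ and let $X_1,\dots,X_m$ be the left-invariant vector fields with $X_j(0)=\partial_{x_j}$, $j=1,\dots,m$; one assumes they satisfy the Hörmander condition. The Lie algebra is stratified, $\mathfrak{g}=V_1\oplus\cdots\oplus V_s$, with $V_1=\operatorname{span}\{X_1,\dots,X_m\}$ and $[V_1,V_j]=V_{j+1}$ for $j\le s-1$. For $u=(u^1,\dots,u^m)\in\mathbb{R}^m$, $u\cdot X:=\sum_{k=1}^m u^kX_k\in V_1$. The map $\exp:\mathfrak{g}\to\mathbb{G}$ is the Lie group exponential: $\exp(Z)$ is the value at time $1$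 of the integral curve of $Z$ starting at $0$. Multiexponential maps: for $p\in\mathbb{N}$ (a positive integer), $\Gamma^{(p)}:(\mathbb{R}^m)^p\to\mathbb{R}^n$, $\Gamma^{(p)}(u_1,\dots,u_p):=\exp(u_1\cdot X)\cdot\exp(u_2\cdot X)\cdots\exp(u_p\cdot X)$. The subRiemannian distance $d(x,y)$ is the infimum of $\int_a^b|u(\tau)|\,d\tau$ over Lipschitz curves $\gamma:[a,b]\to\mathbb{R}^n$ connecting $x$ and $y$ with $\dot\gamma=\sum_{j=1}^m u_j(\tau)X_j(\gamma)$ a.e., where $u\in L^1((a,b),\mathbb{R}^m)$. A map $T:\mathbb{G}\to\mathbb{R}$ is $\mathbb{G}$-linear if $T(x\cdot y)=T(x)+T(y)$ and $T(\delta_\lambda x)=\lambda T(x)$ for all $x,y\in\mathbb{G}$, $\lambda>0$. A function $f:\mathbb{G}\to\mathbb{R}$ is Pansu differentiable at $x$ if there is a $\mathbb{G}$-linear map $T:\mathbb{G}\to\mathbb{R}$ such that $\displaystyle\lim_{y\to0}\frac{f(x\cdot y)-f(x)-T(y)}{d(0,y)}=0$. *)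

theory Defs
  imports "HOL-Analysis.Analysis"
begin

section \<open>Smooth maps and vector fields on Euclidean spaces\<close>

primrec C_k_on_UNIV :: "nat \<Rightarrow> ('a::euclidean_space \<Rightarrow> 'b::euclidean_space) \<Rightarrow> bool" where
  "C_k_on_UNIV 0 f \<longleftrightarrow> continuous_on UNIV f"
| "C_k_on_UNIV (Suc k) f \<longleftrightarrow>
     (\<forall>x. f differentiable (at x)) \<and>
     (\<forall>v. C_k_on_UNIV k (\<lambda>x. frechet_derivative f (at x) v))"

definition smooth_map :: "('a::euclidean_space \<Rightarrow> 'b::euclidean_space) \<Rightarrow> bool" where
  "smooth_map f \<longleftrightarrow> (\<forall>k. C_k_on_UNIV k f)"

text \<open>A vector field is given by its coefficient map; the following is the commutator
  of the associated first order differential operators.\<close>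

definition lie_bracket ::
    "('a::euclidean_space \<Rightarrow> 'a) \<Rightarrow> ('a \<Rightarrow> 'a) \<Rightarrow> 'a \<Rightarrow> 'a" where
  "lie_bracket Y Z x =
     frechet_derivative Z (at x) (Y x) - frechet_derivative Y (at x) (Z x)"

inductive_set iterated_brackets :: "('a::euclidean_space \<Rightarrow> 'a) set \<Rightarrow> ('a \<Rightarrow> 'a) set"
  for F where
  base: "Z \<in> F \<Longrightarrow> Z \<in> iterated_brackets F"
| bracket: "Y \<in> iterated_brackets F \<Longrightarrow> Z \<in> iterated_brackets F \<Longrightarrow>
     lie_bracket Y Z \<in> iterated_brackets F"

definition hoermander_condition :: "('a::euclidean_space \<Rightarrow> 'a) set \<Rightarrow> bool" where
  "hoermander_condition F \<longleftrightarrow> (\<forall>x. span ((\<lambda>Z. Z x) ` iterated_brackets F) = UNIV)"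


section \<open>Carnot groups\<close>

text \<open>The layer structure of the coordinates is recorded by weights: the coordinate \<open>x $ i\<close>
  belongs to \<open>x\<^sup>(\<^sup>j\<^sup>)\<close> iff \<open>w i = j\<close>.\<close>

definition dilation :: "('n \<Rightarrow> nat) \<Rightarrow> real \<Rightarrow> real^'n \<Rightarrow> real^'n" where
  "dilation w r x = (\<chi> i. r ^ w i * x $ i)"

definition left_invariant ::
    "('a::euclidean_space \<Rightarrow> 'a \<Rightarrow> 'a) \<Rightarrow> ('a \<Rightarrow> 'a) \<Rightarrow> bool" where
  "left_invariant mul Z \<longleftrightarrow>
     (\<forall>x y. Z (mul x y) = frechet_derivative (mul x) (at y) (Z y))"

text \<open>The type \<open>'m\<close> indexes the first layer, through the bijection \<open>h\<close> onto the coordinates of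
  weight 1, so that \<open>real^'m\<close> is \<open>\<real>\<^sup>m\<close> with \<open>m = m\<^sub>1\<close>. The requirement
  \<open>range w = {1..s}\<close> says that there are exactly \<open>s\<close> layers, none of them trivial.
  The stratification of the Lie algebra (and that its step is \<open>s\<close>) is a consequence of these
  axioms: a left-invariant field with value \<open>axis i 1\<close> at 0 is dilation-homogeneous of
  degree \<open>w i\<close>.\<close>

locale carnot_group = group mul 0 inv
  for mul :: "real^'n \<Rightarrow> real^'n \<Rightarrow> real^'n" and inv :: "real^'n \<Rightarrow> real^'n" +
  fixes s :: nat
    and w :: "'n \<Rightarrow> nat"
    and h :: "'m::finite \<Rightarrow> 'n"
    and X :: "'m \<Rightarrow> real^'n \<Rightarrow> real^'n"
  assumes smooth_mul: "smooth_map (\<lambda>(x, y). mul x y)"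
    and smooth_inv: "smooth_map inv"
    and range_w: "range w = {1..s}"
    and dilation_mul:
      "r > 0 \<Longrightarrow> dilation w r (mul x y) = mul (dilation w r x) (dilation w r y)"
    and bij_h: "bij_betw h UNIV {i. w i = 1}"
    and left_invariant_X: "left_invariant mul (X j)"
    and X_0: "X j 0 = axis (h j) 1"
    and hoermander_X: "hoermander_condition (range X)"


section \<open>Exponential and multiexponential maps\<close>

definition horizontal_comb ::
    "('m::finite \<Rightarrow> 'a::euclidean_space \<Rightarrow> 'a) \<Rightarrow> real^'m \<Rightarrow> 'a \<Rightarrow> 'a" where
  "horizontal_comb X u x = (\<Sum>k\<in>UNIV. u $ k *\<^sub>R X k x)"

definition lie_exp :: "('a::euclidean_space \<Rightarrow> 'a) \<Rightarrow> 'a" where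
  "lie_exp Z = (THE y. \<exists>\<gamma>. \<gamma> 0 = 0 \<and> \<gamma> (1::real) = y \<and>
     (\<forall>t\<in>{0..1}. (\<gamma> has_vector_derivative Z (\<gamma> t)) (at t within {0..1})))"

text \<open>The factors are indexed by a finite linearly ordered type \<open>'p\<close>, so that \<open>real^'m^'p\<close> is
  \<open>(\<real>\<^sup>m)\<^sup>p\<close> with \<open>p = CARD('p) \<ge> 1\<close>; the product is taken in increasing order of the indices.\<close>

definition multiexp ::
    "('a::euclidean_space \<Rightarrow> 'a \<Rightarrow> 'a) \<Rightarrow> ('m::finite \<Rightarrow> 'a \<Rightarrow> 'a) \<Rightarrow>
     real^'m^'p::{finite,linorder} \<Rightarrow> 'a" where
  "multiexp mul X u =
     foldr mul (map (\<lambda>i. lie_exp (horizontal_comb X (u $ i))) (sorted_list_of_set UNIV)) 0"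


section \<open>SubRiemannian distance and Pansu differentiability\<close>

definition horizontal_curve ::
    "('m::finite \<Rightarrow> 'a::euclidean_space \<Rightarrow> 'a) \<Rightarrow> real \<Rightarrow> real \<Rightarrow>
     (real \<Rightarrow> 'a) \<Rightarrow> (real \<Rightarrow> real^'m) \<Rightarrow> bool" where
  "horizontal_curve X a b \<gamma> u \<longleftrightarrow>
     (\<exists>C. C-lipschitz_on {a..b} \<gamma>) \<and>
     set_integrable lebesgue {a<..<b} u \<and>
     (AE t in lebesgue. t \<in> {a<..<b} \<longrightarrow>
        (\<gamma> has_vector_derivative horizontal_comb X (u t) (\<gamma> t)) (at t))"

text \<open>Under the Hoermander condition any two points are connected by a horizontal curve, so
  the infimum is over a nonempty set of nonnegative reals.\<close>

definition sr_dist :: "('m::finite \<Rightarrow> 'a::euclidean_space \<Rightarrow> 'a) \<Rightarrow> 'a \<Rightarrow> 'a \<Rightarrow> real" where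
  "sr_dist X x y = Inf {LINT t:{a<..<b}|lebesgue. norm (u t) | a b \<gamma> u.
     a < b \<and> horizontal_curve X a b \<gamma> u \<and> \<gamma> a = x \<and> \<gamma> b = y}"

definition G_linear ::
    "(real^'n \<Rightarrow> real^'n \<Rightarrow> real^'n) \<Rightarrow> ('n \<Rightarrow> nat) \<Rightarrow> (real^'n \<Rightarrow> real) \<Rightarrow> bool" where
  "G_linear mul w T \<longleftrightarrow>
     (\<forall>x y. T (mul x y) = T x + T y) \<and> (\<forall>x. \<forall>r>0. T (dilation w r x) = r * T x)"

definition pansu_differentiable ::
    "(real^'n \<Rightarrow> real^'n \<Rightarrow> real^'n) \<Rightarrow> ('n \<Rightarrow> nat) \<Rightarrow> ('m::finite \<Rightarrow> real^'n \<Rightarrow> real^'n) \<Rightarrow>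
     (real^'n \<Rightarrow> real) \<Rightarrow> real^'n \<Rightarrow> bool" where
  "pansu_differentiable mul w X f x \<longleftrightarrow>
     (\<exists>T. G_linear mul w T \<and>
        ((\<lambda>y. (f (mul x y) - f x - T y) / sr_dist X 0 y) \<longlongrightarrow> 0) (at 0))"

end

theory Submission
  imports Defs
begin

text \<open>Let \<open>\<xi> \<noteq> 0\<close> and write \<open>y\<^sup>(\<^sup>1\<^sup>)\<close> for the first layer of \<open>y\<close>. The Pansu differential of \<open>d(0, \<cdot>)\<close> at
\<open>exp (\<xi> \<cdot> X)\<close> is \<open>T y = \<langle>\<xi>, y\<^sup>(\<^sup>1\<^sup>)\<rangle> / \<bar>\<xi>\<bar>\<close>: at this point the distance behaves like the Euclidean norm of
the first layer, up to an error quadratic in \<open>y\<close>.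

Below. The first layer of a horizontal curve has the control as its derivative, so
\<open>d(0, z) \<ge> \<bar>z\<^sup>(\<^sup>1\<^sup>)\<bar>\<close> (\<open>norm_horizontal_part_le_if_joined\<close>). As the first layer of a product is the
sum of the first layers (\<open>mul_first_layer\<close>), convexity of the norm gives
\<open>d(0, exp(\<xi> \<cdot> X) \<cdot> y) \<ge> \<bar>\<xi> + y\<^sup>(\<^sup>1\<^sup>)\<bar> \<ge> \<bar>\<xi>\<bar> + T y\<close> without any error. For \<open>y = 0\<close> the segment is
minimizing, so \<open>d(0, exp(\<xi> \<cdot> X)) = \<bar>\<xi>\<bar>\<close>.

Above. Subdivide the segment into \<open>p\<close> equal pieces and perturb each of them. Since the
differential of the multiexponential map is onto, all points near \<open>exp(\<xi> \<cdot> X)\<close> are reached in this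
way: \<open>exp(\<xi> \<cdot> X) \<cdot> y = \<Gamma>(v\<^sub>1 / p, \<dots>, v\<^sub>p / p)\<close> with \<open>\<bar>v\<^sub>i - \<xi>\<bar> \<le> C \<bar>y\<bar>\<close>
(\<open>multiexp_covers_nbhd\<close>). The concatenated curve has length \<open>(1/p) \<Sum> \<bar>v\<^sub>i\<bar>\<close>. The second order
expansion of the norm at \<open>\<xi>\<close> bounds this by \<open>\<bar>\<xi>\<bar> + T y + O(\<bar>y\<bar>\<^sup>2)\<close>, because the first order terms
only see the mean of the \<open>v\<^sub>i\<close>, and that mean is forced to be \<open>\<xi> + y\<^sup>(\<^sup>1\<^sup>)\<close> by comparing first layers
(\<open>sum_norm_multiexp_le\<close>).

Finally \<open>\<bar>y\<bar> \<le> M d(0, y)\<close> near the origin (\<open>norm_le_if_joined_0\<close>), so an error \<open>O(\<bar>y\<bar>\<^sup>2)\<close> is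
\<open>o(d(0, y))\<close>. That \<open>\<xi> \<noteq> 0\<close> follows from surjectivity: \<open>\<Gamma>\<close> commutes with dilations, so the differential
of \<open>\<Gamma>\<close> at the origin vanishes in the layers of weight at least 2 (\<open>nonzero_if_surj_derivative\<close>).

The exponential is governed by homogeneity: by \<open>X_component_lower\<close>, the \<open>i\<close>-th component of \<open>X\<^sub>j\<close>
depends only on coordinates of weight less than that of \<open>i\<close>. Hence the differential
equation of an integral curve is triangular, and Picard iteration reaches its solution after \<open>s\<close>
steps; this gives existence, uniqueness and continuous dependence together.\<close>

section \<open>Lipschitz curves and maps with surjective derivative\<close>

lemma lipschitz_on_if_continuous_vector_derivative:
  fixes \<gamma> :: "real \<Rightarrow> 'a::euclidean_space"
  assumes der: "\<And>t. t \<in> {a..b} \<Longrightarrow> (\<gamma> has_vector_derivative f t) (at t within {a..b})"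
    and f: "continuous_on {a..b} f"
  shows "\<exists>C. C-lipschitz_on {a..b} \<gamma>"
proof -
  have "compact (f ` {a..b})"
    using f by (intro compact_continuous_image) auto
  then have "bounded (f ` {a..b})" by (rule compact_imp_bounded)
  then obtain B where B: "B > 0" "\<And>t. t \<in> {a..b} \<Longrightarrow> norm (f t) \<le> B"
    unfolding bounded_pos by auto
  have "B-lipschitz_on {a..b} \<gamma>"
  proof (rule lipschitz_onI)
    fix x y assume "x \<in> {a..b}" "y \<in> {a..b}"
    then have "norm (\<gamma> x - \<gamma> y) \<le> B * norm (x - y)"
      using B der unfolding has_vector_derivative_def
      by (intro differentiable_bound[where S = "{a..b}" and f' = "\<lambda>t h. h *\<^sub>R f t"])
        (auto intro!: onorm_le simp: mult.commute[of B] mult_left_mono)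
    then show "dist (\<gamma> x) (\<gamma> y) \<le> B * dist x y" by (simp add: dist_norm)
  qed (use B in auto)
  then show ?thesis by blast
qed

lemma has_vector_derivative_shift_arg:
  assumes "(f has_vector_derivative D) (at (t + c))"
  shows "((\<lambda>t. f (t + c)) has_vector_derivative D) (at t)"
proof -
  have "((\<lambda>t. t + c) has_real_derivative 1) (at t)"
    by (auto intro!: derivative_eq_intros)
  from vector_diff_chain_at[OF this[unfolded has_real_derivative_iff_has_vector_derivative] assms]
  show ?thesis by (simp add: o_def)
qed

text \<open>The fundamental theorem of calculus for Lipschitz curves that are differentiable almost everywhere,
in the form of a bound of the increment. The difference quotients of \<open>\<gamma>\<close> are bounded by the
Lipschitz constant and converge almost everywhere to the derivative, so their integrals converge
to its integral; on the other hand, these integrals are difference quotients of a primitive of \<open>\<gamma>\<close> at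
the two end points, and converge to \<open>\<gamma> b - \<gamma> a\<close>.\<close>

lemma lipschitz_increment_bound:
  fixes \<gamma> :: "real \<Rightarrow> 'a::euclidean_space"
  assumes ab: "a < b" and lip: "C-lipschitz_on {a..b} \<gamma>"
    and der: "AE t in lebesgue. t \<in> {a<..<b} \<longrightarrow>
                (\<exists>D. (\<gamma> has_vector_derivative D) (at t) \<and> norm D \<le> g t)"
    and g: "g integrable_on {a<..<b}"
  shows "norm (\<gamma> b - \<gamma> a) \<le> integral {a<..<b} g"
proof -
  from der obtain N where N: "N \<in> null_sets lebesgue"
    and N': "{t \<in> space lebesgue. \<not> (t \<in> {a<..<b} \<longrightarrow>
                (\<exists>D. (\<gamma> has_vector_derivative D) (at t) \<and> norm D \<le> g t))} \<subseteq> N"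
    unfolding eventually_ae_filter by blast
  have neg: "negligible N" using N by (simp add: negligible_iff_null_sets)
  have derN: "\<exists>D. (\<gamma> has_vector_derivative D) (at t) \<and> norm D \<le> g t"
    if "t \<in> {a<..<b}" "t \<notin> N" for t using N' that by auto
  \<comment> \<open>Extend the curve by constants, so that difference quotients make sense up to the end points.\<close>
  define G where "G t = \<gamma> (max a (min b t))" for t
  have Gab: "G t = \<gamma> t" if "t \<in> {a..b}" for t using that by (simp add: G_def)
  have C: "C \<ge> 0" using lip lipschitz_on_nonneg by blast
  have Glip: "norm (G x - G y) \<le> C * \<bar>x - y\<bar>" for x y
  proof -
    have "dist (G x) (G y) \<le> C * dist (max a (min b x)) (max a (min b y))"
      unfolding G_def using ab by (intro lipschitz_onD[OF lip]) auto
    also have "\<dots> \<le> C * \<bar>x - y\<bar>"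
      using C by (intro mult_left_mono) (auto simp: dist_real_def)
    finally show ?thesis by (simp add: dist_norm)
  qed
  have "C-lipschitz_on UNIV G"
    using Glip C by (intro lipschitz_onI) (auto simp: dist_norm)
  then have Gcont: "continuous_on S G" for S
    using lipschitz_on_continuous_on continuous_on_subset by blast
  define \<Phi> where "\<Phi> x = integral {a - 1..x} G" for x
  have \<Phi>: "(\<Phi> has_vector_derivative G t) (at t)" if "t \<in> {a - 1<..<b + 2}" for t
  proof -
    have "(\<Phi> has_vector_derivative G t) (at t within {a - 1..b + 2})"
      unfolding \<Phi>_def using that by (intro integral_has_vector_derivative Gcont) auto
    then have "(\<Phi> has_vector_derivative G t) (at t within {a - 1<..<b + 2})"
      by (rule has_vector_derivative_within_subset) auto
    then show ?thesis using that at_within_open[of t "{a - 1<..<b + 2}"] by simp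
  qed
  define d where "d n = 1 / (real n + 1)" for n
  have d: "0 < d n" "d n \<le> 1" for n by (auto simp: d_def field_simps)
  have d0: "d \<longlonglongrightarrow> 0"
    unfolding d_def using LIMSEQ_inverse_real_of_nat by (simp add: inverse_eq_divide add.commute)
  have filt: "filterlim d (at 0) sequentially"
    using d d0 by (simp add: filterlim_at less_le)
  have slope: "(\<lambda>n. (G (t + d n) - G t) /\<^sub>R d n) \<longlonglongrightarrow> D"
    if "(G has_vector_derivative D) (at t)" for G :: "real \<Rightarrow> 'a" and t D
  proof -
    have "((\<lambda>h. norm (G (t + h) - G t - h *\<^sub>R D) / norm h) \<longlongrightarrow> 0) (at 0)"
      using that by (simp add: has_vector_derivative_def has_derivative_at)
    moreover have "norm (G (t + h) - G t - h *\<^sub>R D) / norm h = norm ((G (t + h) - G t) /\<^sub>R h - D)"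
      if "h \<noteq> 0" for h
    proof -
      have "(G (t + h) - G t) /\<^sub>R h - D = (G (t + h) - G t - h *\<^sub>R D) /\<^sub>R h"
        using that by (simp add: scaleR_diff_right)
      then show ?thesis by (simp add: divide_inverse mult.commute)
    qed
    ultimately have "((\<lambda>h. norm ((G (t + h) - G t) /\<^sub>R h - D)) \<longlongrightarrow> 0) (at 0)"
      by (subst (asm) tendsto_cong[where g = "\<lambda>h. norm ((G (t + h) - G t) /\<^sub>R h - D)"])
        (auto simp: eventually_at_filter)
    then have "((\<lambda>h. (G (t + h) - G t) /\<^sub>R h) \<longlongrightarrow> D) (at 0)"
      by (rule LIM_zero_cancel[OF tendsto_norm_zero_cancel])
    then show ?thesis using filt by (rule filterlim_compose)
  qed
  \<comment> \<open>Dominated convergence for gauge integrals asks for convergence everywhere; hence the value 0 on \<open>N\<close>.\<close>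
  define q where "q n t = (if t \<in> N then 0 else (G (t + d n) - G t) /\<^sub>R d n)" for n t
  define f where "f t = (if t \<in> N then 0 else vector_derivative \<gamma> (at t))" for t
  have q_int: "(q n has_integral (\<Phi> (b + d n) - \<Phi> b) /\<^sub>R d n - (\<Phi> (a + d n) - \<Phi> a) /\<^sub>R d n) {a<..<b}"
    for n
  proof -
    have 1: "((\<lambda>t. G (t + d n)) has_integral \<Phi> (b + d n) - \<Phi> (a + d n)) {a..b}"
    proof (rule fundamental_theorem_of_calculus)
      fix t assume t: "t \<in> {a..b}"
      have "t + d n \<in> {a - 1<..<b + 2}" using t d[of n] by auto
      from \<Phi>[OF this] have "((\<lambda>t. \<Phi> (t + d n)) has_vector_derivative G (t + d n)) (at t)"
        by (rule has_vector_derivative_shift_arg)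
      then show "((\<lambda>t. \<Phi> (t + d n)) has_vector_derivative G (t + d n)) (at t within {a..b})"
        by (rule has_vector_derivative_at_within)
    qed (use ab in simp)
    have 2: "(G has_integral \<Phi> b - \<Phi> a) {a..b}"
      using ab by (intro fundamental_theorem_of_calculus has_vector_derivative_at_within[OF \<Phi>]) auto
    have "((\<lambda>t. (G (t + d n) - G t) /\<^sub>R d n) has_integral
        ((\<Phi> (b + d n) - \<Phi> (a + d n)) - (\<Phi> b - \<Phi> a)) /\<^sub>R d n) {a..b}"
      using has_integral_cmul[OF has_integral_diff[OF 1 2]] .
    then have "((\<lambda>t. (G (t + d n) - G t) /\<^sub>R d n) has_integral
        ((\<Phi> (b + d n) - \<Phi> (a + d n)) - (\<Phi> b - \<Phi> a)) /\<^sub>R d n) {a<..<b}"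
      using has_integral_Icc_iff_Ioo by blast
    then have "(q n has_integral ((\<Phi> (b + d n) - \<Phi> (a + d n)) - (\<Phi> b - \<Phi> a)) /\<^sub>R d n) {a<..<b}"
      by (rule has_integral_spike[OF neg, rotated]) (simp add: q_def)
    then show ?thesis by (simp add: algebra_simps scaleR_diff_right)
  qed
  have q_lim: "(\<lambda>n. q n t) \<longlonglongrightarrow> f t" if t: "t \<in> {a<..<b}" for t
  proof (cases "t \<in> N")
    case False
    then obtain D where D: "(\<gamma> has_vector_derivative D) (at t)" using derN t by blast
    have "(G has_vector_derivative D) (at t)"
      by (rule has_vector_derivative_transform_within_open[OF D, of "{a<..<b}"])
        (use t Gab in auto)
    from slope[OF this] show ?thesis
      using False D by (simp add: q_def f_def vector_derivative_at)
  qed (simp add: q_def f_def)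
  have q_bound: "norm (q n t) \<le> C" for n t
  proof -
    have "norm ((G (t + d n) - G t) /\<^sub>R d n) = norm (G (t + d n) - G t) / d n"
      using d(1)[of n] by (simp add: divide_inverse mult.commute)
    also have "\<dots> \<le> C"
      using Glip[of "t + d n" t] d(1)[of n] by (simp add: pos_divide_le_eq)
    finally show ?thesis using C by (simp add: q_def)
  qed
  have cint: "(\<lambda>t::real. C) integrable_on {a<..<b}"
    by (metis integrable_on_Icc_iff_Ioo integrable_const_ivl)
  have dc: "f integrable_on {a<..<b}" "(\<lambda>n. integral {a<..<b} (q n)) \<longlonglongrightarrow> integral {a<..<b} f"
    by (rule dominated_convergence[where h = "\<lambda>_. C" and f = q],
        use q_int cint q_bound q_lim in \<open>auto simp: integrable_on_def\<close>)+
  have "(\<lambda>n. integral {a<..<b} (q n)) \<longlonglongrightarrow> G b - G a"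
    unfolding integral_unique[OF q_int]
    using ab by (intro tendsto_diff slope \<Phi>) auto
  then have eq: "integral {a<..<b} f = \<gamma> b - \<gamma> a"
    using LIMSEQ_unique[OF dc(2)] ab Gab[of a] Gab[of b] by simp
  define g' where "g' t = (if t \<in> N then 0 else g t)" for t
  have g': "(g' has_integral integral {a<..<b} g) {a<..<b}"
    by (rule has_integral_spike[OF neg _ integrable_integral[OF g]]) (simp add: g'_def)
  have "norm (integral {a<..<b} f) \<le> integral {a<..<b} g'"
  proof (rule integral_norm_bound_integral)
    show "norm (f t) \<le> g' t" if "t \<in> {a<..<b}" for t
      using derN[OF that] by (auto simp: f_def g'_def vector_derivative_at)
  qed (use dc g' in auto)
  then show ?thesis using eq g' by (simp add: integral_unique)
qed

text \<open>Solving \<open>f y = z\<close> near \<open>x\<close> with a linear bound, where \<open>f\<close> is differentiable at \<open>x\<close> and merely continuous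
elsewhere. Composing with a right inverse of the derivative reduces to a map \<open>\<phi>\<close> that is tangent to the
identity at \<open>0\<close>; on the ball of radius \<open>2 * norm \<eta>\<close> its deviation from the identity is at most
\<open>norm \<eta>\<close>, so Brouwer's theorem yields a solution of \<open>\<phi> y = \<eta>\<close> in this ball.\<close>

lemma open_mapping_linear_bound:
  fixes f :: "'a::euclidean_space \<Rightarrow> 'b::euclidean_space"
  assumes cont: "continuous_on UNIV f" and der: "(f has_derivative f') (at x)" and "surj f'"
  shows "\<exists>C>0. \<exists>e>0. \<forall>z. norm (z - f x) < e \<longrightarrow> (\<exists>y. f y = z \<and> norm (y - x) \<le> C * norm (z - f x))"
proof -
  have lin: "linear f'" using der has_derivative_linear by blast
  obtain g where g: "linear g" "f' \<circ> g = id"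
    using linear_surjective_right_inverse[OF lin \<open>surj f'\<close>] by blast
  obtain B where B: "B > 0" "\<And>z. norm (g z) \<le> B * norm z"
    using linear_bounded_pos[OF g(1)] by blast
  define \<phi> where "\<phi> z = f (x + g z) - f x" for z
  have blg: "bounded_linear g" using g(1) by (simp add: linear_conv_bounded_linear)
  have inner: "((\<lambda>z. x + g z) has_derivative g) (at 0)"
    using bounded_linear_imp_has_derivative[OF blg] by (auto intro!: derivative_eq_intros)
  have "((\<lambda>z. f (x + g z)) has_derivative f' \<circ> g) (at 0)"
    using diff_chain_at[OF inner, of f f'] der linear_0[OF g(1)] by (simp add: o_def)
  then have d\<phi>: "(\<phi> has_derivative id) (at 0)"
    unfolding \<phi>_def g(2) by (auto intro!: derivative_eq_intros)
  have \<phi>0: "\<phi> 0 = 0" by (simp add: \<phi>_def linear_0[OF g(1)])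
  obtain \<delta> where \<delta>: "\<delta> > 0" "\<And>z. norm z < \<delta> \<Longrightarrow> norm (\<phi> z - z) \<le> (1/2) * norm z"
    using d\<phi> unfolding has_derivative_at_alt
    by (metis \<phi>0 diff_zero half_gt_zero_iff id_apply zero_less_one)
  have cont\<phi>: "continuous_on S \<phi>" for S
    unfolding \<phi>_def
    by (intro continuous_intros continuous_on_compose2[OF cont] linear_continuous_on[OF blg]) auto
  have "\<exists>y. f y = z \<and> norm (y - x) \<le> 2 * B * norm (z - f x)" if z: "norm (z - f x) < \<delta> / 2" for z
  proof (cases "z = f x")
    case False
    define \<eta> where "\<eta> = z - f x"
    have "\<exists>y\<in>cball 0 (2 * norm \<eta>). \<phi> y = \<eta>"
    proof (rule brouwer_surjective_cball[where S = "{\<eta>}"])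
      fix a y :: 'b assume a: "a \<in> {\<eta>}" and y: "y \<in> cball 0 (2 * norm \<eta>)"
      have ny: "norm y \<le> 2 * norm \<eta>" using y by simp
      then have "norm (\<phi> y - y) \<le> (1/2) * norm y" using z by (intro \<delta>) (simp add: \<eta>_def)
      then have "norm (\<eta> - (\<phi> y - y)) \<le> 2 * norm \<eta>"
        using norm_triangle_ineq4[of \<eta> "\<phi> y - y"] ny by linarith
      then show "a + (y - \<phi> y) \<in> cball 0 (2 * norm \<eta>)" using a by (simp add: algebra_simps)
    qed (use False cont\<phi> in \<open>auto simp: \<eta>_def\<close>)
    then obtain y where y: "norm y \<le> 2 * norm \<eta>" "\<phi> y = \<eta>" by auto
    have "norm (g y) \<le> B * (2 * norm \<eta>)"
      using B(2)[of y] mult_left_mono[OF y(1), of B] B(1) by linarith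
    then show ?thesis
      using y(2) by (intro exI[of _ "x + g y"]) (simp add: \<phi>_def \<eta>_def mult.assoc mult.left_commute)
  qed (auto intro: exI[of _ x])
  then show ?thesis using B(1) \<delta>(1) by (intro exI[of _ "2 * B"] conjI exI[of _ "\<delta> / 2"]) auto
qed

lemma norm_add_ge_tangent:
  fixes \<xi> q :: "'a::real_inner"
  assumes "\<xi> \<noteq> 0"
  shows "norm (\<xi> + q) \<ge> norm \<xi> + (\<xi> \<bullet> q) / norm \<xi>"
proof -
  have "\<xi> \<bullet> (\<xi> + q) \<le> norm \<xi> * norm (\<xi> + q)" by (rule norm_cauchy_schwarz)
  then show ?thesis using assms
    by (simp add: inner_add_right field_simps power2_norm_eq_inner[symmetric] power2_eq_square)
qed

text \<open>The square of \<open>norm \<xi> - norm (\<xi> + q)\<close> is nonnegative: this is the concavity of the square root.\<close>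

lemma norm_add_le_tangent:
  fixes \<xi> q :: "'a::real_inner"
  assumes "\<xi> \<noteq> 0"
  shows "norm (\<xi> + q) \<le> norm \<xi> + (\<xi> \<bullet> q) / norm \<xi> + (norm q)\<^sup>2 / (2 * norm \<xi>)"
proof -
  have "(norm (\<xi> + q))\<^sup>2 = (norm \<xi>)\<^sup>2 + 2 * (\<xi> \<bullet> q) + (norm q)\<^sup>2"
    by (simp add: power2_norm_eq_inner inner_add inner_commute)
  moreover have "0 \<le> (norm \<xi> - norm (\<xi> + q))\<^sup>2" by simp
  ultimately have "2 * norm \<xi> * norm (\<xi> + q) \<le> 2 * (norm \<xi>)\<^sup>2 + 2 * (\<xi> \<bullet> q) + (norm q)\<^sup>2"
    by (simp add: power2_diff)
  then show ?thesis using assms by (simp add: field_simps power2_eq_square)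
qed

lemma lipschitz_cball_if_C1:
  fixes f :: "'a::euclidean_space \<Rightarrow> 'b::euclidean_space"
  assumes diff: "\<And>x. f differentiable (at x)"
    and cont: "\<And>v. continuous_on UNIV (\<lambda>x. frechet_derivative f (at x) v)"
  shows "\<exists>K. K-lipschitz_on (cball 0 R) f"
proof -
  have "\<exists>B. \<forall>x\<in>cball 0 R. norm (frechet_derivative f (at x) v) \<le> B" for v
  proof -
    have "bounded ((\<lambda>x. frechet_derivative f (at x) v) ` cball 0 R)"
      by (intro compact_imp_bounded compact_continuous_image continuous_on_subset[OF cont]) auto
    then show ?thesis by (auto simp: bounded_iff)
  qed
  then obtain B where B: "\<And>v x. x \<in> cball 0 R \<Longrightarrow> norm (frechet_derivative f (at x) v) \<le> B v"
    by metis
  define K where "K = (\<Sum>b\<in>Basis. \<bar>B b\<bar>)"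
  have "K-lipschitz_on (cball 0 R) f"
  proof (rule lipschitz_onI)
    have "norm (f x - f y) \<le> K * norm (x - y)" if "x \<in> cball 0 R" "y \<in> cball 0 R" for x y
    proof (rule differentiable_bound[OF convex_cball _ _ that])
      fix x :: 'a assume x: "x \<in> cball 0 R"
      have der: "(f has_derivative frechet_derivative f (at x)) (at x)"
        using diff frechet_derivative_works by blast
      then show "(f has_derivative frechet_derivative f (at x)) (at x within cball 0 R)"
        by (rule has_derivative_at_withinI)
      have lin: "linear (frechet_derivative f (at x))" using der has_derivative_linear by blast
      show "onorm (frechet_derivative f (at x)) \<le> K"
      proof (rule onorm_le)
        fix v
        have "frechet_derivative f (at x) v = (\<Sum>b\<in>Basis. (v \<bullet> b) *\<^sub>R frechet_derivative f (at x) b)"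
          by (subst euclidean_representation[of v, symmetric])
            (simp add: linear_sum[OF lin] linear_cmul[OF lin] del: euclidean_representation)
        also have "norm \<dots> \<le> (\<Sum>b\<in>Basis. \<bar>B b\<bar> * norm v)"
        proof (rule sum_norm_le)
          fix b :: 'a assume "b \<in> Basis"
          then have "\<bar>v \<bullet> b\<bar> * norm (frechet_derivative f (at x) b) \<le> norm v * \<bar>B b\<bar>"
            using B[OF x, of b] by (intro mult_mono Basis_le_norm) auto
          then show "norm ((v \<bullet> b) *\<^sub>R frechet_derivative f (at x) b) \<le> \<bar>B b\<bar> * norm v"
            by (simp add: mult.commute)
        qed
        finally show "norm (frechet_derivative f (at x) v) \<le> K * norm v"
          by (simp add: K_def sum_distrib_right)
      qed
    qed
    then show "dist (f x) (f y) \<le> K * dist x y" if "x \<in> cball 0 R" "y \<in> cball 0 R" for x y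
      using that by (simp add: dist_norm)
    show "K \<ge> 0" by (simp add: K_def sum_nonneg)
  qed
  then show ?thesis by blast
qed

lemma nonpos_if_le_linear_near_0:
  fixes A B :: real
  assumes "\<And>r. 0 < r \<Longrightarrow> r \<le> 1 \<Longrightarrow> A \<le> B * r"
  shows "A \<le> 0"
proof (rule tendsto_lowerbound)
  have "((\<lambda>r. B * r) \<longlongrightarrow> B * 0) (at_right 0)" by (intro tendsto_intros)
  then show "((\<lambda>r. B * r) \<longlongrightarrow> 0) (at_right 0)" by simp
  show "\<forall>\<^sub>F r in at_right 0. A \<le> B * r"
    using assms by (auto simp: eventually_at_right[of 0 1] intro!: exI[of _ 1])
qed simp

lemma has_derivative_imp_linear_bound:
  assumes "(f has_derivative f') (at x)"
  shows "\<exists>K>0. \<exists>d>0. \<forall>y. norm (y - x) < d \<longrightarrow> norm (f y - f x) \<le> K * norm (y - x)"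
proof -
  obtain K where K: "K > 0" "\<And>v. norm (f' v) \<le> K * norm v"
    using bounded_linear.pos_bounded[OF has_derivative_bounded_linear[OF assms]]
    by (auto simp: mult.commute)
  obtain d where d: "d > 0" "\<And>y. norm (y - x) < d \<Longrightarrow> norm (f y - f x - f' (y - x)) \<le> norm (y - x)"
    using assms unfolding has_derivative_at_alt by (metis mult_1 zero_less_one)
  have "norm (f y - f x) \<le> (K + 1) * norm (y - x)" if "norm (y - x) < d" for y
    using d(2)[OF that] K(2)[of "y - x"] norm_triangle_sub[of "f y - f x" "f' (y - x)"]
    by (simp add: algebra_simps)
  then show ?thesis using K(1) d(1) by (intro exI[of _ "K + 1"]) auto
qed

section \<open>Homogeneity of the horizontal fields\<close>

lemma dilation_nth [simp]: "dilation w r x $ i = r ^ w i * x $ i"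
  by (simp add: dilation_def)

lemma linear_dilation: "linear (dilation w r)"
  by (rule linearI) (simp_all add: vec_eq_iff algebra_simps)

lemma bounded_linear_dilation: "bounded_linear (dilation w r)"
  using linear_dilation by (rule linear_conv_bounded_linear[THEN iffD1])

lemma dilation_has_derivative [derivative_intros]:
  assumes "(f has_derivative f') (at x within S)"
  shows "((\<lambda>x. dilation w r (f x)) has_derivative (\<lambda>v. dilation w r (f' v))) (at x within S)"
  by (rule bounded_linear.has_derivative[OF bounded_linear_dilation assms])

lemma horizontal_comb_scaleR: "horizontal_comb X (t *\<^sub>R u) x = t *\<^sub>R horizontal_comb X u x"
  by (simp add: horizontal_comb_def scaleR_sum_right)

lemma horizontal_comb_0: "horizontal_comb X 0 x = 0"
  by (simp add: horizontal_comb_def)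

context carnot_group
begin

sublocale monoid mul 0 ..

lemma weight_ge_1: "1 \<le> w i"
  using range_w by (metis atLeastAtMost_iff rangeI)

lemma dilation_zero_left [simp]: "dilation w 0 x = 0"
proof -
  have "w i \<noteq> 0" for i using weight_ge_1[of i] by simp
  then show ?thesis by (simp add: vec_eq_iff)
qed

lemma weight_h [simp]: "w (h j) = 1"
  using bij_h by (auto simp: bij_betw_def)

lemma dilation_0 [simp]: "dilation w r 0 = 0"
  by (simp add: vec_eq_iff)

abbreviation Mul :: "(real^'n) \<times> (real^'n) \<Rightarrow> real^'n" where
  "Mul \<equiv> \<lambda>(x, y). mul x y"

lemma Mul_has_derivative: "(Mul has_derivative frechet_derivative Mul (at p)) (at p)"
proof -
  have "Mul differentiable (at p)"
    using smooth_mul[unfolded smooth_map_def, rule_format, of "Suc 0"] unfolding C_k_on_UNIV.simps by blast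
  then show ?thesis by (simp only: frechet_derivative_works)
qed

lemma continuous_on_mul [continuous_intros]:
  assumes "continuous_on S f" "continuous_on S g"
  shows "continuous_on S (\<lambda>x. mul (f x) (g x))"
proof -
  have "continuous_on UNIV Mul"
    using smooth_mul[unfolded smooth_map_def, rule_format, of 0] by simp
  from continuous_on_compose2[OF this continuous_on_Pair[OF assms]] show ?thesis by simp
qed

lemma mul_left_has_derivative':
  "(mul x has_derivative (\<lambda>v. frechet_derivative Mul (at (x, y)) (0, v))) (at y)"
proof -
  have "((\<lambda>y. (x, y)) has_derivative (\<lambda>v. (0, v))) (at y)"
    by (auto intro!: derivative_eq_intros)
  from diff_chain_at[OF this Mul_has_derivative] show ?thesis by (simp add: o_def)
qed

lemma mul_left_has_derivative:
  "(mul x has_derivative frechet_derivative (mul x) (at y)) (at y)"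
  using mul_left_has_derivative' frechet_derivative_at by metis

text \<open>By left invariance the field is a partial derivative of the multiplication, and so it inherits
its regularity.\<close>

lemma X_eq: "X j x = frechet_derivative Mul (at (x, 0)) (0, axis (h j) 1)"
proof -
  have "X j x = X j (mul x 0)" by simp
  also have "\<dots> = frechet_derivative (mul x) (at 0) (axis (h j) 1)"
    using left_invariant_X X_0 unfolding left_invariant_def by metis
  finally show ?thesis
    using frechet_derivative_at[OF mul_left_has_derivative'[of x 0]] by metis
qed

lemma X_C1:
  "X j differentiable (at x)"
  "continuous_on UNIV (\<lambda>x. frechet_derivative (X j) (at x) v)"
proof -
  define H where "H p = frechet_derivative Mul (at p) (0, axis (h j) 1)" for p
  have H: "H differentiable (at p)" "continuous_on UNIV (\<lambda>p. frechet_derivative H (at p) v)" for p v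
    using smooth_mul[unfolded smooth_map_def, rule_format, of "Suc (Suc 0)"]
    unfolding H_def C_k_on_UNIV.simps by blast+
  have XH: "X j = (\<lambda>x. H (x, 0))" by (simp add: fun_eq_iff X_eq H_def)
  have der: "(X j has_derivative (\<lambda>v. frechet_derivative H (at (x, 0)) (v, 0))) (at x)" for x
  proof -
    have "((\<lambda>x. (x, 0)) has_derivative (\<lambda>v. (v, 0))) (at x)"
      by (auto intro!: derivative_eq_intros)
    from diff_chain_at[OF this H(1)[unfolded frechet_derivative_works]] show ?thesis
      unfolding XH by (simp add: o_def)
  qed
  then show "X j differentiable (at x)" using differentiableI by blast
  have "continuous_on UNIV (\<lambda>x. frechet_derivative H (at (x, 0)) (v, 0))"
    by (rule continuous_on_compose2[OF H(2)]) (auto intro!: continuous_intros)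
  then show "continuous_on UNIV (\<lambda>x. frechet_derivative (X j) (at x) v)"
    by (simp only: frechet_derivative_at[OF der, symmetric])
qed

lemma continuous_on_X: "continuous_on UNIV (X j)"
  using X_C1(1) differentiable_imp_continuous_on differentiable_on_def
  by (metis differentiable_at_withinI)

lemma continuous_on_horizontal_comb [continuous_intros]:
  assumes "continuous_on S f" "continuous_on S g"
  shows "continuous_on S (\<lambda>x. horizontal_comb X (f x) (g x))"
  unfolding horizontal_comb_def
  by (intro continuous_intros assms continuous_on_compose2[OF continuous_on_X assms(2)]) auto

lemma horizontal_comb_mul:
  "horizontal_comb X u (mul x y) = frechet_derivative (mul x) (at y) (horizontal_comb X u y)"
proof -
  have lin: "linear (frechet_derivative (mul x) (at y))"
    using mul_left_has_derivative has_derivative_linear by blast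
  show ?thesis
    using left_invariant_X
    by (simp add: horizontal_comb_def linear_sum[OF lin] linear_cmul[OF lin] left_invariant_def)
qed

text \<open>The field \<open>X j\<close> is homogeneous of degree 1: differentiate
\<open>\<delta>\<^sub>r x \<cdot> \<delta>\<^sub>r y = \<delta>\<^sub>r (x \<cdot> y)\<close> in \<open>y\<close> at \<open>0\<close>, in a direction of weight 1.\<close>

lemma X_dilation:
  assumes "r > 0"
  shows "r *\<^sub>R X j (dilation w r x) = dilation w r (X j x)"
proof -
  let ?e = "axis (h j) 1 :: real^'n"
  have X: "X j x = frechet_derivative (mul x) (at 0) ?e" for x
    using left_invariant_X X_0 right_neutral unfolding left_invariant_def by metis
  have re: "dilation w r ?e = r *\<^sub>R ?e"
    by (simp add: vec_eq_iff axis_def)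
  have lin: "linear (frechet_derivative (mul (dilation w r x)) (at 0))"
    using mul_left_has_derivative has_derivative_linear by blast
  have "((\<lambda>y. mul (dilation w r x) (dilation w r y)) has_derivative
      (\<lambda>v. frechet_derivative (mul (dilation w r x)) (at 0) (dilation w r v))) (at 0)"
    using diff_chain_at[OF bounded_linear_imp_has_derivative[OF bounded_linear_dilation]
        mul_left_has_derivative[of "dilation w r x" "dilation w r 0"]] by (simp add: o_def)
  moreover have "((\<lambda>y. dilation w r (mul x y)) has_derivative
      (\<lambda>v. dilation w r (frechet_derivative (mul x) (at 0) v))) (at 0)"
    by (intro derivative_intros mul_left_has_derivative)
  ultimately have "(\<lambda>v. frechet_derivative (mul (dilation w r x)) (at 0) (dilation w r v)) =
      (\<lambda>v. dilation w r (frechet_derivative (mul x) (at 0) v))"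
    using dilation_mul[OF assms] by (simp add: has_derivative_unique)
  from fun_cong[OF this, of ?e] show ?thesis
    by (simp add: X re linear_cmul[OF lin])
qed

lemma horizontal_comb_dilation:
  assumes "r > 0"
  shows "r *\<^sub>R horizontal_comb X u (dilation w r x) = dilation w r (horizontal_comb X u x)"
proof -
  have "r *\<^sub>R horizontal_comb X u (dilation w r x) =
      (\<Sum>k\<in>UNIV. u $ k *\<^sub>R (r *\<^sub>R X k (dilation w r x)))"
    by (simp add: horizontal_comb_def scaleR_sum_right mult.commute)
  then show ?thesis
    by (simp add: X_dilation[OF assms] horizontal_comb_def linear_sum[OF linear_dilation]
        linear_cmul[OF linear_dilation])
qed

text \<open>The component \<open>X j x $ i\<close> is homogeneous of degree \<open>w i - 1\<close> and locally Lipschitz. If \<open>x\<close> and \<open>y\<close>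
differ only in coordinates of weight at least \<open>w i\<close>, then \<open>\<delta>\<^sub>r x - \<delta>\<^sub>r y\<close> is of order \<open>r ^ w i\<close>, hence so
is the difference of the values at these points. By homogeneity it is \<open>r ^ (w i - 1)\<close> times
the difference at \<open>x\<close> and \<open>y\<close>, which must therefore be \<open>O(r)\<close> for every small \<open>r\<close>.\<close>

lemma X_component_lower:
  assumes eq: "\<And>l. w l < w i \<Longrightarrow> x $ l = y $ l"
  shows "X j x $ i = X j y $ i"
proof -
  \<comment> \<open>The ball contains \<open>\<delta>\<^sub>r x\<close> and \<open>\<delta>\<^sub>r y\<close> for all \<open>r \<le> 1\<close>, so one Lipschitz constant serves all of them.\<close>
  obtain K where K: "K-lipschitz_on (cball 0 (norm x + norm y)) (X j)"
    using lipschitz_cball_if_C1 X_C1 by blast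
  have "\<bar>X j x $ i - X j y $ i\<bar> \<le> (K * norm (x - y)) * r" if r: "0 < r" "r \<le> 1" for r
  proof -
    have small: "norm (dilation w r z) \<le> norm z" for z :: "real^'n"
      using r by (intro norm_le_componentwise_cart)
        (auto simp: abs_mult power_le_one mult_left_le_one_le)
    have "norm (dilation w r x - dilation w r y) \<le> norm (r ^ w i *\<^sub>R (x - y))"
    proof (rule norm_le_componentwise_cart)
      fix l
      show "norm ((dilation w r x - dilation w r y) $ l) \<le> norm ((r ^ w i *\<^sub>R (x - y)) $ l)"
      proof (cases "w l < w i")
        case False
        then have "r ^ w l * \<bar>x $ l - y $ l\<bar> \<le> r ^ w i * \<bar>x $ l - y $ l\<bar>"
          using r by (intro mult_right_mono power_decreasing) auto
        then show ?thesis using r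
          by (simp add: abs_mult right_diff_distrib[symmetric])
      qed (simp add: eq)
    qed
    then have nd: "norm (dilation w r x - dilation w r y) \<le> r ^ w i * norm (x - y)" using r by simp
    have "r ^ w i * \<bar>X j x $ i - X j y $ i\<bar> = \<bar>(dilation w r (X j x) - dilation w r (X j y)) $ i\<bar>"
      using r by (simp add: abs_mult right_diff_distrib[symmetric])
    also have "\<dots> \<le> norm (dilation w r (X j x) - dilation w r (X j y))"
      by (rule component_le_norm_cart)
    also have "\<dots> = r * norm (X j (dilation w r x) - X j (dilation w r y))"
      using r by (simp add: X_dilation[symmetric] scaleR_diff_right[symmetric])
    also have "\<dots> \<le> r * (K * norm (dilation w r x - dilation w r y))"
      using r small[of x] small[of y] norm_ge_zero[of x] norm_ge_zero[of y]
      by (intro mult_left_mono lipschitz_on_normD[OF K])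
        (auto simp del: norm_ge_zero)
    also have "\<dots> \<le> r * (K * (r ^ w i * norm (x - y)))"
      using r nd lipschitz_on_nonneg[OF K] by (intro mult_left_mono) auto
    finally have "r ^ w i * \<bar>X j x $ i - X j y $ i\<bar> \<le> r ^ w i * (K * norm (x - y) * r)"
      by (simp add: mult_ac)
    then show ?thesis using r by simp
  qed
  then have "\<bar>X j x $ i - X j y $ i\<bar> \<le> 0" by (rule nonpos_if_le_linear_near_0)
  then show ?thesis by simp
qed

lemma horizontal_comb_lower:
  assumes "\<And>l. w l < w i \<Longrightarrow> x $ l = y $ l"
  shows "horizontal_comb X u x $ i = horizontal_comb X u y $ i"
proof -
  have "X k x $ i = X k y $ i" for k using assms by (rule X_component_lower)
  then show ?thesis by (simp add: horizontal_comb_def)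
qed

text \<open>On the first layer the multiplication is homogeneous of degree 1 along the curves
\<open>r \<mapsto> (\<delta>\<^sub>r x, \<delta>\<^sub>r y)\<close>, so it equals the derivative of the multiplication at the origin along the
initial velocity of this curve. In particular it is linear, and it is then determined by
\<open>mul x 0 = x\<close> and \<open>mul 0 y = y\<close>.\<close>

lemma mul_first_layer:
  assumes "w i = 1"
  shows "mul x y $ i = x $ i + y $ i"
proof -
  define D where "D = frechet_derivative Mul (at 0)"
  \<comment> \<open>The initial velocity of \<open>r \<mapsto> \<delta>\<^sub>r x\<close>: coordinates of higher weight start with velocity 0.\<close>
  define pr :: "real^'n \<Rightarrow> real^'n" where "pr x = (\<chi> l. if w l = 1 then x $ l else 0)" for x
  have linD: "linear D"
    using Mul_has_derivative has_derivative_linear unfolding D_def by blast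
  have key: "mul x y $ i = D (pr x, pr y) $ i" for x y
  proof -
    have dil: "((\<lambda>r. dilation w r z) has_vector_derivative pr z) (at 0)" for z
    proof -
      have "((\<lambda>r. r ^ w l * z $ l) has_real_derivative pr z $ l) (at 0)" for l
        using weight_ge_1[of l]
        by (cases "w l = 1") (auto intro!: derivative_eq_intros simp: pr_def)
      then have comp: "((\<lambda>r. r ^ w l * z $ l) has_derivative (\<lambda>t. t * pr z $ l)) (at 0)" for l
        by (simp add: has_field_derivative_def mult_commute_abs)
      show ?thesis
        unfolding has_vector_derivative_def
      proof (subst has_derivative_componentwise_within, rule ballI)
        fix b :: "real^'n" assume "b \<in> Basis"
        then obtain l where b: "b = axis l 1" by (auto simp: Basis_vec_def)
        show "((\<lambda>r. dilation w r z \<bullet> b) has_derivative (\<lambda>t. t *\<^sub>R pr z \<bullet> b)) (at 0)"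
          using comp[of l] by (simp add: b inner_axis)
      qed
    qed
    have curve: "((\<lambda>r. (dilation w r x, dilation w r y)) has_derivative (\<lambda>t. t *\<^sub>R (pr x, pr y))) (at 0)"
      unfolding has_vector_derivative_def[symmetric] by (intro has_vector_derivative_Pair dil)
    have "(Mul has_derivative D) (at (dilation w 0 x, dilation w 0 y))"
      using Mul_has_derivative[of 0] by (simp add: D_def zero_prod_def)
    from diff_chain_at[OF curve this]
    have "((\<lambda>r. mul (dilation w r x) (dilation w r y)) has_vector_derivative D (pr x, pr y)) (at 0)"
      by (simp add: has_vector_derivative_def o_def linear_cmul[OF linD] del: scaleR_Pair)
    then have "((\<lambda>r. mul (dilation w r x) (dilation w r y) $ i) has_vector_derivative D (pr x, pr y) $ i)
        (at 0 within {0..})"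
      by (rule has_vector_derivative_at_within[OF bounded_linear.has_vector_derivative[OF bounded_linear_vec_nth]])
    then have 1: "((\<lambda>r. r * mul x y $ i) has_vector_derivative D (pr x, pr y) $ i) (at 0 within {0..})"
    proof (rule has_vector_derivative_transform[rotated 2])
      fix r :: real assume r: "r \<in> {0..}"
      show "r * mul x y $ i = mul (dilation w r x) (dilation w r y) $ i"
        using r assms by (cases "r = 0") (simp_all add: dilation_mul[symmetric])
    qed simp
    have 2: "((\<lambda>r. r * mul x y $ i) has_vector_derivative mul x y $ i) (at 0 within {0..})"
      unfolding has_real_derivative_iff_has_vector_derivative[symmetric]
      by (auto intro!: derivative_eq_intros)
    show ?thesis
      by (rule vector_derivative_unique_within[OF _ 2 1])
        (simp add: trivial_limit_at_right_real at_within_Ici_at_right)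
  qed
  have "D (pr x, pr y) = D (pr x, 0) + D (0, pr y)"
    using linear_add[OF linD, of "(pr x, 0)" "(0, pr y)"] by simp
  moreover have "pr 0 = 0" by (simp add: pr_def vec_eq_iff)
  ultimately show ?thesis using key[of x y] key[of x 0] key[of 0 y] by simp
qed

lemma X_first_layer: "X j x $ h k = (if j = k then 1 else 0)"
proof -
  have X: "X j x = frechet_derivative (mul x) (at 0) (axis (h j) 1)"
    using left_invariant_X X_0 right_neutral unfolding left_invariant_def by metis
  have "((\<lambda>y. mul x y $ h k) has_derivative (\<lambda>v. frechet_derivative (mul x) (at 0) v $ h k)) (at 0)"
    by (intro bounded_linear.has_derivative[OF bounded_linear_vec_nth] mul_left_has_derivative)
  moreover have "((\<lambda>y. mul x y $ h k) has_derivative (\<lambda>v. v $ h k)) (at 0)"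
    unfolding mul_first_layer[OF weight_h]
    by (auto intro!: derivative_eq_intros bounded_linear.has_derivative[OF bounded_linear_vec_nth])
  ultimately have "(\<lambda>v. frechet_derivative (mul x) (at 0) v $ h k) = (\<lambda>v. v $ h k)"
    by (rule has_derivative_unique)
  from fun_cong[OF this] have "X j x $ h k = axis (h j) 1 $ h k" by (simp add: X)
  then show ?thesis using bij_h by (auto simp: axis_def bij_betw_def inj_eq)
qed

lemma horizontal_comb_first_layer [simp]: "horizontal_comb X u x $ h k = u $ k"
  by (simp add: horizontal_comb_def X_first_layer if_distrib cong: if_cong)

end

section \<open>The exponential of horizontal fields\<close>

text \<open>Picard iteration for the integral curve of \<open>u \<cdot> X\<close> from the origin, recorded at time 1 only. As a
function of \<open>u\<close> this contains the whole iterates: the value at time \<open>t\<close> for \<open>u\<close> is the value at time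
\<open>1\<close> for \<open>t u\<close>. In this form the continuity in \<open>u\<close> is continuity of an integral in a parameter.\<close>

primrec picard :: "('m::finite \<Rightarrow> real^'n \<Rightarrow> real^'n) \<Rightarrow> nat \<Rightarrow> real^'m \<Rightarrow> real^'n" where
  "picard X 0 u = 0"
| "picard X (Suc k) u = integral {0..1} (\<lambda>\<sigma>. horizontal_comb X u (picard X k (\<sigma> *\<^sub>R u)))"

context carnot_group
begin

lemma continuous_on_picard: "continuous_on UNIV (picard X k)"
proof (induction k)
  case (Suc k)
  have "continuous_on UNIV (\<lambda>u. integral (cbox 0 1) (\<lambda>\<sigma>. horizontal_comb X u (picard X k (\<sigma> *\<^sub>R u))))"
    by (rule integral_continuous_on_param)
      (auto simp: case_prod_beta intro!: continuous_intros continuous_on_compose2[OF Suc])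
  then show ?case by (simp add: fun_eq_iff)
qed simp

lemma continuous_on_picard_ray: "continuous_on S (\<lambda>\<sigma>. horizontal_comb X u (picard X k (\<sigma> *\<^sub>R u)))"
  by (intro continuous_intros continuous_on_compose2[OF continuous_on_picard]) auto

text \<open>The components of weight at most \<open>k\<close> no longer change after \<open>k\<close> steps, because their increments
involve only components of smaller weight.\<close>

lemma picard_component_stable: "w i \<le> k \<Longrightarrow> picard X (Suc k) u $ i = picard X k u $ i"
proof (induction k arbitrary: i u)
  case 0
  then show ?case using weight_ge_1[of i] by simp
next
  case (Suc k)
  have comp: "picard X (Suc n) u $ i = integral {0..1} (\<lambda>\<sigma>. horizontal_comb X u (picard X n (\<sigma> *\<^sub>R u)) $ i)"
    for n
    unfolding picard.simps
    by (intro integral_component_eq_cart[symmetric] integrable_continuous_real continuous_on_picard_ray)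
  have "horizontal_comb X u (picard X (Suc k) v) $ i = horizontal_comb X u (picard X k v) $ i" for v
    using Suc by (intro horizontal_comb_lower) auto
  then show ?case by (simp only: comp)
qed

lemma picard_0 [simp]: "picard X k 0 = 0"
  by (cases k) (simp_all add: horizontal_comb_0)

lemma picard_fixed_point: "picard X (Suc s) u = picard X s u"
proof -
  have "w i \<le> s" for i using range_w by (metis atLeastAtMost_iff rangeI)
  then show ?thesis by (auto simp: vec_eq_iff picard_component_stable simp del: picard.simps)
qed

lemma picard_ray:
  assumes "0 \<le> t"
  shows "picard X s (t *\<^sub>R u) = integral {0..t} (\<lambda>\<tau>. horizontal_comb X u (picard X s (\<tau> *\<^sub>R u)))"
proof (cases "t = 0")
  case True
  then show ?thesis by simp
next
  case False
  let ?g = "\<lambda>\<tau>. horizontal_comb X u (picard X s (\<tau> *\<^sub>R u))"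
  have "(?g has_integral integral {0..t} ?g) (cbox 0 t)"
    unfolding cbox_interval by (intro integrable_integral integrable_continuous_real continuous_on_picard_ray)
  from has_integral_affinity'[OF this, of t 0] False assms
  have "((\<lambda>\<sigma>. ?g (t * \<sigma>)) has_integral integral {0..t} ?g /\<^sub>R t) {0..1}" by simp
  from has_integral_cmul[OF this, of t] False
  have "((\<lambda>\<sigma>. t *\<^sub>R ?g (t * \<sigma>)) has_integral integral {0..t} ?g) {0..1}" by simp
  then have "integral {0..1} (\<lambda>\<sigma>. t *\<^sub>R ?g (t * \<sigma>)) = integral {0..t} ?g"
    by (rule integral_unique)
  moreover have "picard X (Suc s) (t *\<^sub>R u) = integral {0..1} (\<lambda>\<sigma>. t *\<^sub>R ?g (t * \<sigma>))"
    by (simp add: horizontal_comb_scaleR mult.commute)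
  ultimately show ?thesis by (simp only: picard_fixed_point)
qed

lemma picard_integral_curve:
  assumes "t \<in> {0..T}"
  shows "((\<lambda>t. picard X s (t *\<^sub>R u)) has_vector_derivative horizontal_comb X u (picard X s (t *\<^sub>R u)))
    (at t within {0..T})"
proof (rule has_vector_derivative_transform[OF assms])
  show "((\<lambda>t. integral {0..t} (\<lambda>\<tau>. horizontal_comb X u (picard X s (\<tau> *\<^sub>R u)))) has_vector_derivative
      horizontal_comb X u (picard X s (t *\<^sub>R u))) (at t within {0..T})"
    by (intro integral_has_vector_derivative continuous_on_picard_ray assms)
qed (simp add: picard_ray)

text \<open>Induction over the weights: once the components of smaller weight agree, two solutions have the same
derivative in the component \<open>i\<close>.\<close>

lemma integral_curve_unique:
  assumes "\<And>t. t \<in> {0..1} \<Longrightarrow> (\<alpha> has_vector_derivative horizontal_comb X u (\<alpha> t)) (at t within {0..1})"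
    and "\<And>t. t \<in> {0..1} \<Longrightarrow> (\<beta> has_vector_derivative horizontal_comb X u (\<beta> t)) (at t within {0..1})"
    and "\<alpha> 0 = \<beta> 0" and "t \<in> {0..1::real}"
  shows "\<alpha> t = \<beta> t"
proof -
  have "\<forall>t\<in>{0..1}. \<alpha> t $ i = \<beta> t $ i" for i
  proof (induction i rule: measure_induct_rule[of w])
    case (less i)
    have "((\<lambda>t. \<alpha> t $ i - \<beta> t $ i) has_vector_derivative 0) (at t within {0..1})"
      if t: "t \<in> {0..1}" for t
    proof -
      have "((\<lambda>t. (\<alpha> t - \<beta> t) $ i) has_vector_derivative
          (horizontal_comb X u (\<alpha> t) - horizontal_comb X u (\<beta> t)) $ i) (at t within {0..1})"
        by (rule bounded_linear.has_vector_derivative[OF bounded_linear_vec_nth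
            has_vector_derivative_diff[OF assms(1,2)[OF t]]])
      moreover have "horizontal_comb X u (\<alpha> t) $ i = horizontal_comb X u (\<beta> t) $ i"
        using less t by (intro horizontal_comb_lower) blast
      ultimately show ?thesis by simp
    qed
    then obtain c where "\<And>t. t \<in> {0..1} \<Longrightarrow> \<alpha> t $ i - \<beta> t $ i = c"
      using has_vector_derivative_zero_constant[of "{0..1::real}" "\<lambda>t. \<alpha> t $ i - \<beta> t $ i"] by auto
    from this[of 0] this show ?case using assms(3) by force
  qed
  then show ?thesis using assms(4) by (simp add: vec_eq_iff)
qed

abbreviation Exp :: "real^'m \<Rightarrow> real^'n" where
  "Exp u \<equiv> lie_exp (horizontal_comb X u)"

lemma Exp_eqI:
  assumes "\<gamma> 0 = 0"
    and "\<And>t. t \<in> {0..1} \<Longrightarrow> (\<gamma> has_vector_derivative horizontal_comb X u (\<gamma> t)) (at t within {0..1})"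
  shows "Exp u = \<gamma> 1"
  unfolding lie_exp_def
proof (rule the_equality)
  show "\<exists>\<gamma>'. \<gamma>' 0 = 0 \<and> \<gamma>' 1 = \<gamma> 1 \<and>
      (\<forall>t\<in>{0..1}. (\<gamma>' has_vector_derivative horizontal_comb X u (\<gamma>' t)) (at t within {0..1}))"
    using assms by blast
  fix y
  assume "\<exists>\<gamma>. \<gamma> 0 = 0 \<and> \<gamma> 1 = y \<and>
      (\<forall>t\<in>{0..1}. (\<gamma> has_vector_derivative horizontal_comb X u (\<gamma> t)) (at t within {0..1}))"
  then obtain \<beta> where "\<beta> 0 = 0" "\<beta> 1 = y"
    "\<And>t. t \<in> {0..1} \<Longrightarrow> (\<beta> has_vector_derivative horizontal_comb X u (\<beta> t)) (at t within {0..1})"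
    by blast
  then show "y = \<gamma> 1" using integral_curve_unique[of \<beta> u \<gamma> 1] assms by simp
qed

lemma Exp_eq_picard: "Exp u = picard X s u"
  using Exp_eqI[of "\<lambda>t. picard X s (t *\<^sub>R u)" u] picard_integral_curve[of _ 1] by simp

lemma Exp_0 [simp]: "Exp 0 = 0"
  by (simp add: Exp_eq_picard)

lemma continuous_on_Exp: "continuous_on UNIV Exp"
  using continuous_on_picard by (simp add: Exp_eq_picard)

lemma Exp_integral_curve:
  assumes "t \<in> {0..T}"
  shows "((\<lambda>t. Exp (t *\<^sub>R u)) has_vector_derivative horizontal_comb X u (Exp (t *\<^sub>R u))) (at t within {0..T})"
  using picard_integral_curve[OF assms] by (simp only: Exp_eq_picard)

lemma mul_integral_curve:
  assumes "(\<gamma> has_vector_derivative horizontal_comb X u (\<gamma> t)) (at t within S)"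
  shows "((\<lambda>t. mul x (\<gamma> t)) has_vector_derivative horizontal_comb X u (mul x (\<gamma> t))) (at t within S)"
  using vector_derivative_diff_chain_within[OF assms has_derivative_at_withinI[OF mul_left_has_derivative]]
  by (simp add: o_def horizontal_comb_mul)

text \<open>The dilation of an integral curve of \<open>u \<cdot> X\<close> is an integral curve of \<open>r u \<cdot> X\<close>.\<close>

lemma Exp_dilation:
  assumes "r > 0"
  shows "Exp (r *\<^sub>R u) = dilation w r (Exp u)"
proof -
  have "Exp (r *\<^sub>R u) = dilation w r (Exp (1 *\<^sub>R u))"
  proof (rule Exp_eqI)
    fix t :: real assume "t \<in> {0..1}"
    from Exp_integral_curve[OF this]
    have "((\<lambda>t. dilation w r (Exp (t *\<^sub>R u))) has_vector_derivative
        dilation w r (horizontal_comb X u (Exp (t *\<^sub>R u)))) (at t within {0..1})"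
      by (rule bounded_linear.has_vector_derivative[OF bounded_linear_dilation])
    then show "((\<lambda>t. dilation w r (Exp (t *\<^sub>R u))) has_vector_derivative
        horizontal_comb X (r *\<^sub>R u) (dilation w r (Exp (t *\<^sub>R u)))) (at t within {0..1})"
      by (simp add: horizontal_comb_scaleR horizontal_comb_dilation[OF assms])
  qed simp
  then show ?thesis by simp
qed

text \<open>Both sides are the end points of integral curves of \<open>u \<cdot> X\<close> that start at \<open>Exp (n u)\<close>: on the left the
continuation of the ray, on the right the translate of its initial piece.\<close>

lemma Exp_Suc: "Exp (real (Suc n) *\<^sub>R u) = mul (Exp (real n *\<^sub>R u)) (Exp u)"
proof -
  have "Exp ((real n + 1) *\<^sub>R u) = mul (Exp (real n *\<^sub>R u)) (Exp (1 *\<^sub>R u))"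
  proof (rule integral_curve_unique[where \<alpha> = "\<lambda>t. Exp ((real n + t) *\<^sub>R u)"
        and \<beta> = "\<lambda>t. mul (Exp (real n *\<^sub>R u)) (Exp (t *\<^sub>R u))" and u = u])
    fix t :: real assume t: "t \<in> {0..1}"
    show "((\<lambda>t. mul (Exp (real n *\<^sub>R u)) (Exp (t *\<^sub>R u))) has_vector_derivative
        horizontal_comb X u (mul (Exp (real n *\<^sub>R u)) (Exp (t *\<^sub>R u)))) (at t within {0..1})"
      by (intro mul_integral_curve Exp_integral_curve t)
    have img: "(\<lambda>t. real n + t) ` {0..1} = {real n..real n + 1}"
      by (simp add: image_add_atLeastAtMost add.commute)
    have "((\<lambda>t. real n + t) has_vector_derivative 1) (at t within {0..1})"
      by (auto intro!: derivative_eq_intros simp: has_real_derivative_iff_has_vector_derivative[symmetric])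
    moreover have "((\<lambda>t. Exp (t *\<^sub>R u)) has_vector_derivative horizontal_comb X u (Exp ((real n + t) *\<^sub>R u)))
        (at (real n + t) within (\<lambda>t. real n + t) ` {0..1})"
      unfolding img using t
      by (intro has_vector_derivative_within_subset[OF Exp_integral_curve[where T = "real n + 1"]]) auto
    ultimately show "((\<lambda>t. Exp ((real n + t) *\<^sub>R u)) has_vector_derivative
        horizontal_comb X u (Exp ((real n + t) *\<^sub>R u))) (at t within {0..1})"
      using vector_diff_chain_within by (fastforce simp: o_def)
  qed auto
  then show ?thesis by (simp add: add.commute)
qed

lemma Exp_first_layer: "Exp u $ h k = u $ k"
proof -
  have "((\<lambda>t. Exp (t *\<^sub>R u) $ h k - t * u $ k) has_vector_derivative 0) (at t within {0..1})"
    if "t \<in> {0..1}" for t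
  proof -
    have "((\<lambda>t. Exp (t *\<^sub>R u) $ h k) has_vector_derivative u $ k) (at t within {0..1})"
      using bounded_linear.has_vector_derivative[OF bounded_linear_vec_nth[of "h k"] Exp_integral_curve[OF that, of u]]
      by simp
    moreover have "((\<lambda>t. t * u $ k) has_vector_derivative u $ k) (at t within {0..1})"
      unfolding has_real_derivative_iff_has_vector_derivative[symmetric]
      by (auto intro!: derivative_eq_intros)
    ultimately show ?thesis using has_vector_derivative_diff by fastforce
  qed
  then obtain c where c: "\<And>t. t \<in> {0..1} \<Longrightarrow> Exp (t *\<^sub>R u) $ h k - t * u $ k = c"
    using has_vector_derivative_zero_constant[of "{0..1::real}" "\<lambda>t. Exp (t *\<^sub>R u) $ h k - t * u $ k"] by auto
  show ?thesis using c[of 0] c[of 1] by simp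
qed

end

section \<open>Lengths of horizontal curves\<close>

text \<open>The competitors in the definition of \<open>sr_dist\<close>, sorted by their length.\<close>

definition horizontally_joined :: "('m::finite \<Rightarrow> 'a::euclidean_space \<Rightarrow> 'a) \<Rightarrow> 'a \<Rightarrow> 'a \<Rightarrow> real \<Rightarrow> bool" where
  "horizontally_joined X x y L \<longleftrightarrow> (\<exists>a b \<gamma> u. a < b \<and> horizontal_curve X a b \<gamma> u \<and> \<gamma> a = x \<and> \<gamma> b = y \<and>
     L = (LINT t:{a<..<b}|lebesgue. norm (u t)))"

lemma sr_dist_eq_Inf: "sr_dist X x y = Inf {L. horizontally_joined X x y L}"
  unfolding sr_dist_def horizontally_joined_def by (rule arg_cong[where f = Inf]) blast

lemma joined_nonneg: "horizontally_joined X x y L \<Longrightarrow> 0 \<le> L"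
  by (auto simp: horizontally_joined_def set_lebesgue_integral_def intro!: integral_nonneg_AE)

lemma sr_dist_le:
  assumes "horizontally_joined X x y L"
  shows "sr_dist X x y \<le> L"
  unfolding sr_dist_eq_Inf using assms joined_nonneg
  by (intro cInf_lower bdd_belowI[of _ 0]) auto

text \<open>A single competitor is required, since the infimum of the empty set is unspecified.\<close>

lemma le_sr_dist:
  assumes "horizontally_joined X x y L\<^sub>0" and "\<And>L. horizontally_joined X x y L \<Longrightarrow> c \<le> L"
  shows "c \<le> sr_dist X x y"
  unfolding sr_dist_eq_Inf using assms by (intro cInf_greatest) auto

lemma joined_refl: "horizontally_joined X x x 0"
  unfolding horizontally_joined_def
proof (intro exI conjI)
  show "horizontal_curve X 0 1 (\<lambda>_. x) (\<lambda>_. 0)"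
    unfolding horizontal_curve_def
    by (auto simp: horizontal_comb_0 set_integrable_def intro: lipschitz_on_constant)
qed (simp_all add: set_lebesgue_integral_def)

lemma set_integral_const_interval:
  fixes c :: "'a::euclidean_space"
  assumes "a \<le> b"
  shows "set_integrable lebesgue {a..<b::real} (\<lambda>_. c)"
    and "(LINT t:{a..<b}|lebesgue. norm c) = (b - a) * norm c"
  using assms by (auto simp: set_integrable_def set_integral_const intro!: integrable_indicator)

text \<open>The common part of the two lower bounds for lengths: \<open>P\<close> is the projection to the first layer in
one of them, and the identity in the other.\<close>

lemma joined_increment_le:
  fixes P :: "'a::euclidean_space \<Rightarrow> 'b::euclidean_space"
  assumes P: "bounded_linear P" and M: "M \<ge> 0"
    and ab: "a < b" and lip: "C-lipschitz_on {a..b} \<gamma>"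
    and u: "set_integrable lebesgue {a<..<b} u"
    and der: "AE t in lebesgue. t \<in> {a<..<b} \<longrightarrow>
        (\<gamma> has_vector_derivative horizontal_comb X (u t) (\<gamma> t)) (at t)"
    and bound: "\<And>t. t \<in> {a<..<b} \<Longrightarrow> norm (P (horizontal_comb X (u t) (\<gamma> t))) \<le> M * norm (u t)"
  shows "norm (P (\<gamma> b) - P (\<gamma> a)) \<le> M * (LINT t:{a<..<b}|lebesgue. norm (u t))"
proof -
  note ni = set_lebesgue_integral_eq_integral[OF set_integrable_norm[OF u]]
  obtain K where K: "K \<ge> 0" "\<And>x. norm (P x) \<le> K * norm x"
    using bounded_linear.nonneg_bounded[OF P] by (auto simp: mult.commute)
  have "K-lipschitz_on UNIV P"
    using K by (intro lipschitz_onI) (simp_all add: dist_norm linear_diff[OF bounded_linear.linear[OF P], symmetric])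
  then have "(K * C)-lipschitz_on {a..b} (\<lambda>t. P (\<gamma> t))"
    by (intro lipschitz_on_compose2[OF lip]) (rule lipschitz_on_subset, auto)
  moreover have "AE t in lebesgue. t \<in> {a<..<b} \<longrightarrow>
      (\<exists>D. ((\<lambda>t. P (\<gamma> t)) has_vector_derivative D) (at t) \<and> norm D \<le> M * norm (u t))"
    using der
  proof eventually_elim
    case (elim t)
    then show ?case
      using bounded_linear.has_vector_derivative[OF P] bound by blast
  qed
  ultimately have "norm (P (\<gamma> b) - P (\<gamma> a)) \<le> integral {a<..<b} (\<lambda>t. M * norm (u t))"
    using ni(1) by (intro lipschitz_increment_bound[OF ab]) (auto intro: integrable_on_mult_right)
  then show ?thesis using ni(2) by simp
qed

context carnot_group
begin

text \<open>Append to the curve the left translate by \<open>z\<close> of the integral curve of \<open>v \<cdot> X\<close>, run on a unit interval.\<close>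

lemma joined_snoc:
  assumes "horizontally_joined X x z L"
  shows "horizontally_joined X x (mul z (Exp v)) (L + norm v)"
proof -
  from assms obtain a b \<gamma> u C where ab: "a < b" and lip: "C-lipschitz_on {a..b} \<gamma>"
    and u: "set_integrable lebesgue {a<..<b} u"
    and der: "AE t in lebesgue. t \<in> {a<..<b} \<longrightarrow>
        (\<gamma> has_vector_derivative horizontal_comb X (u t) (\<gamma> t)) (at t)"
    and ends: "\<gamma> a = x" "\<gamma> b = z" and L: "L = (LINT t:{a<..<b}|lebesgue. norm (u t))"
    unfolding horizontally_joined_def horizontal_curve_def by blast
  define \<delta> where "\<delta> t = mul z (Exp ((t - b) *\<^sub>R v))" for t
  have shift: "((\<lambda>t. t - b) has_vector_derivative 1) (at t within S)" for t S
    by (auto intro!: derivative_eq_intros simp: has_real_derivative_iff_has_vector_derivative[symmetric])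
  have img: "(\<lambda>t. t - b) ` {b..b + 1} = {0..1}"
    using image_diff_atLeastAtMost by (simp add: image_add_atLeastAtMost[of "-b", simplified])
  have \<delta>: "(\<delta> has_vector_derivative horizontal_comb X v (\<delta> t)) (at t within {b..b + 1})"
    if t: "t \<in> {b..b + 1}" for t
    unfolding \<delta>_def
  proof (rule mul_integral_curve)
    have "((\<lambda>t. Exp (t *\<^sub>R v)) has_vector_derivative horizontal_comb X v (Exp ((t - b) *\<^sub>R v)))
        (at (t - b) within (\<lambda>t. t - b) ` {b..b + 1})"
      unfolding img using t by (intro Exp_integral_curve) auto
    from vector_diff_chain_within[OF shift this]
    show "((\<lambda>t. Exp ((t - b) *\<^sub>R v)) has_vector_derivative horizontal_comb X v (Exp ((t - b) *\<^sub>R v)))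
        (at t within {b..b + 1})" by (simp add: o_def)
  qed
  have "continuous_on {b..b + 1} \<delta>"
    by (rule continuous_on_vector_derivative[OF \<delta>])
  from lipschitz_on_if_continuous_vector_derivative[OF \<delta> continuous_on_horizontal_comb[OF continuous_on_const this]]
  obtain C' where lip': "C'-lipschitz_on {b..b + 1} \<delta>" by blast
  define \<gamma>' where "\<gamma>' t = (if t \<le> b then \<gamma> t else \<delta> t)" for t
  define u' where "u' t = (if t < b then u t else v)" for t
  have "(max C C')-lipschitz_on {a..b + 1} \<gamma>'"
    unfolding \<gamma>'_def
  proof (rule lipschitz_on_concat)
    show "\<gamma> b = \<delta> b" by (simp add: ends \<delta>_def)
  qed (use lip lip' in \<open>auto intro: lipschitz_on_mono\<close>)
  moreover have split: "{a<..<b + 1} = {a<..<b} \<union> {b..<b + 1}" using ab by auto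
  have i1: "set_integrable lebesgue {a<..<b} u'"
    using u by (subst set_integrable_cong[of lebesgue lebesgue "{a<..<b}" "{a<..<b}" u' u]) (auto simp: u'_def)
  have i2: "set_integrable lebesgue {b..<b + 1} u'"
    using set_integral_const_interval(1)[of b "b + 1" v]
    by (subst set_integrable_cong[of lebesgue lebesgue "{b..<b + 1}" "{b..<b + 1}" u' "\<lambda>_. v"]) (auto simp: u'_def)
  have int: "set_integrable lebesgue {a<..<b + 1} u'"
    unfolding split by (intro set_integrable_Un i1 i2) auto
  have "AE t in lebesgue. t \<noteq> b"
    by (rule AE_completion[OF AE_lborel_singleton])
  with der have "AE t in lebesgue. t \<in> {a<..<b + 1} \<longrightarrow>
        (\<gamma>' has_vector_derivative horizontal_comb X (u' t) (\<gamma>' t)) (at t)"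
  proof eventually_elim
    case (elim t)
    show ?case
    proof
      assume t: "t \<in> {a<..<b + 1}"
      consider "t < b" | "b < t" using elim by linarith
      then show "(\<gamma>' has_vector_derivative horizontal_comb X (u' t) (\<gamma>' t)) (at t)"
      proof cases
        case 1
        then have "(\<gamma> has_vector_derivative horizontal_comb X (u' t) (\<gamma>' t)) (at t)"
          using elim t by (simp add: u'_def \<gamma>'_def)
        then show ?thesis
          by (rule has_vector_derivative_transform_within_open[where S = "{..<b}"])
            (use 1 in \<open>auto simp: \<gamma>'_def\<close>)
      next
        case 2
        have "(\<delta> has_vector_derivative horizontal_comb X v (\<delta> t)) (at t within {b<..<b + 1})"
          using 2 t by (intro has_vector_derivative_within_subset[OF \<delta>]) auto
        then have "(\<delta> has_vector_derivative horizontal_comb X (u' t) (\<gamma>' t)) (at t)"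
          using 2 t at_within_open[of t "{b<..<b + 1}"] by (simp add: u'_def \<gamma>'_def)
        then show ?thesis
          by (rule has_vector_derivative_transform_within_open[where S = "{b<..}"])
            (use 2 in \<open>auto simp: \<gamma>'_def\<close>)
      qed
    qed
  qed
  ultimately have curve: "horizontal_curve X a (b + 1) \<gamma>' u'"
    using int unfolding horizontal_curve_def by blast
  have "(LINT t:{a<..<b + 1}|lebesgue. norm (u' t)) =
      (LINT t:{a<..<b}|lebesgue. norm (u' t)) + (LINT t:{b..<b + 1}|lebesgue. norm (u' t))"
    unfolding split by (intro set_integral_Un set_integrable_norm i1 i2) auto
  also have "(LINT t:{a<..<b}|lebesgue. norm (u' t)) = L"
    unfolding L by (intro set_lebesgue_integral_cong) (auto simp: u'_def)
  also have "(LINT t:{b..<b + 1}|lebesgue. norm (u' t)) = (LINT t:{b..<b + 1}|lebesgue. norm v)"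
    by (intro set_lebesgue_integral_cong) (auto simp: u'_def)
  also have "\<dots> = norm v" using set_integral_const_interval(2)[of b "b + 1" v] by simp
  finally have "L + norm v = (LINT t:{a<..<b + 1}|lebesgue. norm (u' t))" by simp
  moreover have "\<gamma>' a = x" "\<gamma>' (b + 1) = mul z (Exp v)"
    using ab ends by (auto simp: \<gamma>'_def \<delta>_def)
  ultimately show ?thesis
    unfolding horizontally_joined_def using ab curve by (intro exI[of _ a] exI[of _ "b + 1"] exI[of _ \<gamma>'] exI[of _ u']) auto
qed

definition horizontal_part :: "real^'n \<Rightarrow> real^'m" where
  "horizontal_part x = (\<chi> k. x $ h k)"

lemma bounded_linear_horizontal_part: "bounded_linear horizontal_part"
  by (rule linear_conv_bounded_linear[THEN iffD1], rule linearI) (simp_all add: horizontal_part_def vec_eq_iff)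

lemma horizontal_part_0 [simp]: "horizontal_part 0 = 0" by (simp add: horizontal_part_def vec_eq_iff)

lemma horizontal_part_mul [simp]: "horizontal_part (mul x y) = horizontal_part x + horizontal_part y"
  by (simp add: horizontal_part_def vec_eq_iff mul_first_layer)

lemma horizontal_part_dilation [simp]: "horizontal_part (dilation w r x) = r *\<^sub>R horizontal_part x"
  by (simp add: horizontal_part_def vec_eq_iff)

lemma horizontal_part_Exp [simp]: "horizontal_part (Exp u) = u"
  by (simp add: horizontal_part_def vec_eq_iff Exp_first_layer)

lemma horizontal_part_horizontal_comb [simp]: "horizontal_part (horizontal_comb X u x) = u"
  by (simp add: horizontal_part_def vec_eq_iff)

lemma norm_horizontal_part_le_if_joined:
  assumes "horizontally_joined X x y L"
  shows "norm (horizontal_part y - horizontal_part x) \<le> L"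
  using assms unfolding horizontally_joined_def horizontal_curve_def
  by (auto dest!: joined_increment_le[OF bounded_linear_horizontal_part zero_le_one])

text \<open>While a curve from the origin stays in the unit ball, where the fields are bounded by \<open>M\<close>, its
distance from the origin is at most \<open>M\<close> times its length. If it leaves the ball, then the piece up to
the first exit already has length at least \<open>1 / M\<close>.\<close>

lemma norm_le_if_joined_0:
  obtains M where "M > 0" "\<And>y L. norm y \<le> 1 \<Longrightarrow> horizontally_joined X 0 y L \<Longrightarrow> norm y \<le> M * L"
proof -
  have "\<exists>B. \<forall>x\<in>cball 0 1. norm (X k x) \<le> B" for k
  proof -
    have "bounded (X k ` cball 0 1)"
      by (intro compact_imp_bounded compact_continuous_image continuous_on_subset[OF continuous_on_X]) auto
    then show ?thesis by (auto simp: bounded_iff)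
  qed
  then obtain B where B: "\<And>k x. x \<in> cball 0 1 \<Longrightarrow> norm (X k x) \<le> B k" by metis
  define M where "M = 1 + (\<Sum>k\<in>UNIV. \<bar>B k\<bar>)"
  have M: "M > 0" unfolding M_def by (simp add: add_pos_nonneg sum_nonneg)
  have comb: "norm (horizontal_comb X u x) \<le> M * norm u" if "norm x \<le> 1" for u x
  proof -
    have "norm (horizontal_comb X u x) \<le> (\<Sum>k\<in>UNIV. \<bar>B k\<bar> * norm u)"
      unfolding horizontal_comb_def
    proof (rule sum_norm_le)
      fix k
      have "\<bar>u $ k\<bar> * norm (X k x) \<le> norm u * \<bar>B k\<bar>"
        using B[of x k] that component_le_norm_cart[of u k] by (intro mult_mono) auto
      then show "norm (u $ k *\<^sub>R X k x) \<le> \<bar>B k\<bar> * norm u" by (simp add: mult.commute)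
    qed
    also have "\<dots> \<le> M * norm u" by (simp add: M_def sum_distrib_right[symmetric] mult_right_mono)
    finally show ?thesis .
  qed
  have "norm y \<le> M * L" if y: "norm y \<le> 1" and "horizontally_joined X 0 y L" for y L
  proof -
    from that(2) obtain a b \<gamma> u C where ab: "a < b" and lip: "C-lipschitz_on {a..b} \<gamma>"
      and u: "set_integrable lebesgue {a<..<b} u"
      and der: "AE t in lebesgue. t \<in> {a<..<b} \<longrightarrow>
          (\<gamma> has_vector_derivative horizontal_comb X (u t) (\<gamma> t)) (at t)"
      and ends: "\<gamma> a = 0" "\<gamma> b = y" and L: "L = (LINT t:{a<..<b}|lebesgue. norm (u t))"
      unfolding horizontally_joined_def horizontal_curve_def by blast
    have initial: "norm (\<gamma> c) \<le> M * L"
      if c: "a < c" "c \<le> b" and small: "\<And>t. t \<in> {a<..<c} \<Longrightarrow> norm (\<gamma> t) \<le> 1" for c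
    proof -
      have uc: "set_integrable lebesgue {a<..<c} u"
        using u by (rule set_integrable_subset) (use c in auto)
      have "AE t in lebesgue. t \<in> {a<..<c} \<longrightarrow>
          (\<gamma> has_vector_derivative horizontal_comb X (u t) (\<gamma> t)) (at t)"
        using der by eventually_elim (use c in auto)
      then have "norm (\<gamma> c - \<gamma> a) \<le> M * (LINT t:{a<..<c}|lebesgue. norm (u t))"
        using M lip c comb small
        by (intro joined_increment_le[OF bounded_linear_ident _ c(1) _ uc]) (auto intro: lipschitz_on_subset)
      also have "\<dots> \<le> M * L"
        unfolding L using M c
          set_lebesgue_integral_eq_integral[OF set_integrable_norm[OF u]]
          set_lebesgue_integral_eq_integral[OF set_integrable_norm[OF uc]]
        by (auto intro!: mult_left_mono integral_subset_le)
      finally show ?thesis using ends by simp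
    qed
    define S where "S = {t\<in>{a..b}. norm (\<gamma> t) \<ge> 1}"
    have cont: "continuous_on {a..b} \<gamma>" using lip lipschitz_on_continuous_on by blast
    show ?thesis
    proof (cases "S = {}")
      case True
      then have "\<not> norm (\<gamma> t) \<ge> 1" if "t \<in> {a<..<b}" for t using that by (auto simp: S_def)
      then have "norm (\<gamma> t) \<le> 1" if "t \<in> {a<..<b}" for t using that by (simp add: less_imp_le not_le)
      then show ?thesis using initial[of b] ab ends by simp
    next
      case False
      have "S = {a..b} \<inter> (\<lambda>t. norm (\<gamma> t)) -` {1..}" by (auto simp: S_def)
      then have "closed S"
        using continuous_closed_preimage[OF continuous_on_norm[OF cont] closed_atLeastAtMost closed_atLeast]
        by simp
      moreover have "bounded S" by (rule bounded_subset[of "{a..b}"]) (auto simp: S_def)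
      ultimately have "compact S" by (simp add: compact_eq_bounded_closed)
      then obtain c where c: "c \<in> S" "\<And>t. t \<in> S \<Longrightarrow> c \<le> t"
        using compact_attains_inf[OF _ False] by blast
      have "a \<le> c" "c \<le> b" "norm (\<gamma> c) \<ge> 1" using c(1) by (auto simp: S_def)
      moreover from this have "a < c" using ends(1) by (cases "a = c") auto
      moreover have "norm (\<gamma> t) \<le> 1" if "t \<in> {a<..<c}" for t
        using c(2)[of t] that \<open>c \<le> b\<close> by (cases "norm (\<gamma> t) \<ge> 1") (auto simp: S_def)
      ultimately have "norm (\<gamma> c) \<ge> 1" "norm (\<gamma> c) \<le> M * L" using initial by simp_all
      then show ?thesis using y by linarith
    qed
  qed
  then show ?thesis using M that by blast
qed

lemma foldr_mul: "foldr mul xs y = mul (foldr mul xs 0) y"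
  by (induction xs) (simp_all add: assoc)

lemma joined_foldr_Exp: "horizontally_joined X 0 (foldr mul (map Exp us) 0) (\<Sum>u\<leftarrow>us. norm u)"
proof (induction us rule: rev_induct)
  case (snoc v us)
  then show ?case using joined_snoc[OF snoc, of v] foldr_mul[of "map Exp us" "Exp v"] by simp
qed (simp add: joined_refl)

text \<open>Run the integral curve of \<open>u \<cdot> X\<close> backwards and translate it to the origin.\<close>

lemma Exp_uminus: "Exp (- u) = inv (Exp u)"
proof -
  have "Exp (- u) = mul (inv (Exp u)) (Exp ((1 - 1) *\<^sub>R u))"
  proof (rule Exp_eqI[where \<gamma> = "\<lambda>t. mul (inv (Exp u)) (Exp ((1 - t) *\<^sub>R u))"])
    fix t :: real assume t: "t \<in> {0..1}"
    have img: "(\<lambda>t. 1 - t) ` {0..1} = {0..1::real}" by simp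
    have "((\<lambda>t. Exp (t *\<^sub>R u)) has_vector_derivative horizontal_comb X u (Exp ((1 - t) *\<^sub>R u)))
        (at (1 - t) within (\<lambda>t. 1 - t) ` {0..1})"
      unfolding img using t by (intro Exp_integral_curve) auto
    moreover have "((\<lambda>t. 1 - t) has_vector_derivative - 1) (at t within {0..1})"
      by (auto intro!: derivative_eq_intros simp: has_real_derivative_iff_has_vector_derivative[symmetric])
    ultimately have "((\<lambda>t. Exp ((1 - t) *\<^sub>R u)) has_vector_derivative
        horizontal_comb X (- u) (Exp ((1 - t) *\<^sub>R u))) (at t within {0..1})"
      using vector_diff_chain_within horizontal_comb_scaleR[of X "- 1" u] by (fastforce simp: o_def)
    then show "((\<lambda>t. mul (inv (Exp u)) (Exp ((1 - t) *\<^sub>R u))) has_vector_derivative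
        horizontal_comb X (- u) (mul (inv (Exp u)) (Exp ((1 - t) *\<^sub>R u)))) (at t within {0..1})"
      by (rule mul_integral_curve)
  qed simp
  then show ?thesis by simp
qed

end

section \<open>Multiexponential maps and differentiability of the distance\<close>

context carnot_group
begin

abbreviation ordered_exps :: "real^'m^'p::{finite,linorder} \<Rightarrow> 'p list \<Rightarrow> real^'n" where
  "ordered_exps u is \<equiv> foldr mul (map (\<lambda>i. Exp (u $ i)) is) 0"

lemma continuous_on_multiexp: "continuous_on UNIV (multiexp mul X :: real^'m^'p::{finite,linorder} \<Rightarrow> _)"
proof -
  have "continuous_on UNIV (\<lambda>u :: real^'m^'p::{finite,linorder}. ordered_exps u is)" for "is"
    by (induction "is") (auto intro!: continuous_intros continuous_on_compose2[OF continuous_on_Exp])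
  then show ?thesis by (simp add: multiexp_def[abs_def])
qed

lemma multiexp_dilation:
  assumes "r > 0"
  shows "multiexp mul X (r *\<^sub>R u) = dilation w r (multiexp mul X u)"
proof -
  have "ordered_exps (r *\<^sub>R u) is = dilation w r (ordered_exps u is)" for "is"
    by (induction "is") (simp_all add: Exp_dilation[OF assms] dilation_mul[OF assms])
  then show ?thesis by (simp add: multiexp_def)
qed

lemma multiexp_diagonal:
  "multiexp mul X ((\<chi> i. v) :: real^'m^'p::{finite,linorder}) = Exp (real CARD('p) *\<^sub>R v)"
proof -
  have "ordered_exps (\<chi> i. v) is = Exp (real (length is) *\<^sub>R v)" for "is" :: "'p list"
  proof (induction "is" rule: rev_induct)
    case (snoc i "is")
    then show ?case
      using foldr_mul[of "map (\<lambda>i. Exp v) is" "Exp v"] Exp_Suc[of "length is" v] by simp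
  qed simp
  then show ?thesis by (simp add: multiexp_def)
qed

lemma horizontal_part_multiexp: "horizontal_part (multiexp mul X u) = (\<Sum>i\<in>UNIV. u $ i)"
proof -
  have "horizontal_part (ordered_exps u is) = (\<Sum>i\<leftarrow>is. u $ i)" for "is" by (induction "is") simp_all
  then show ?thesis by (simp add: multiexp_def sum_list_distinct_conv_sum_set)
qed

lemma joined_multiexp: "horizontally_joined X 0 (multiexp mul X u) (\<Sum>i\<in>UNIV. norm (u $ i))"
  using joined_foldr_Exp[of "map (\<lambda>i. u $ i) (sorted_list_of_set UNIV)"]
  by (simp add: multiexp_def o_def sum_list_distinct_conv_sum_set)

text \<open>For a coordinate of weight 2 (it exists because \<open>s \<ge> 2\<close>), the map \<open>r \<mapsto> \<Gamma>(r v)\<close> is quadratic in \<open>r \<ge> 0\<close>, so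
its derivative at \<open>r = 0\<close> vanishes and that coordinate is missed by the differential at \<open>0\<close>.\<close>

lemma nonzero_if_surj_derivative:
  fixes \<xi> :: "real^'m" and D\<Gamma> :: "real^'m^'p::{finite,linorder} \<Rightarrow> real^'n"
  assumes "s \<ge> 2" and der: "(multiexp mul X has_derivative D\<Gamma>) (at (\<chi> i. \<xi>))" and "surj D\<Gamma>"
  shows "\<xi> \<noteq> 0"
proof
  have zero: "(\<chi> i. 0) = (0 :: real^'m^'p::{finite,linorder})" by (simp add: vec_eq_iff)
  assume "\<xi> = 0"
  then have der0: "(multiexp mul X has_derivative D\<Gamma>) (at 0)"
    using der by (simp add: zero)
  obtain i where i: "w i = 2" using range_w \<open>s \<ge> 2\<close> by (metis atLeastAtMost_iff imageE one_le_numeral)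
  have mul0: "multiexp mul X (0 :: real^'m^'p::{finite,linorder}) = 0"
    using multiexp_diagonal[where 'p = 'p, of 0] by (simp add: zero)
  obtain v where v: "D\<Gamma> v = axis i 1" using \<open>surj D\<Gamma>\<close> by (metis surjD)
  have lin: "linear D\<Gamma>" using der has_derivative_linear by blast
  have "((\<lambda>r. r *\<^sub>R v) has_derivative (\<lambda>t. t *\<^sub>R v)) (at (0::real))"
    by (auto intro!: derivative_eq_intros)
  from diff_chain_at[OF this, of "multiexp mul X" D\<Gamma>] der0
  have "((\<lambda>r. multiexp mul X (r *\<^sub>R v)) has_vector_derivative D\<Gamma> v) (at (0::real))"
    by (simp add: has_vector_derivative_def o_def linear_cmul[OF lin])
  then have "((\<lambda>r. multiexp mul X (r *\<^sub>R v) $ i) has_vector_derivative D\<Gamma> v $ i) (at (0::real) within {0..})"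
    by (rule has_vector_derivative_at_within[OF bounded_linear.has_vector_derivative[OF bounded_linear_vec_nth]])
  then have 1: "((\<lambda>r. r\<^sup>2 * multiexp mul X v $ i) has_vector_derivative D\<Gamma> v $ i) (at (0::real) within {0..})"
  proof (rule has_vector_derivative_transform[rotated 2])
    fix r :: real assume r: "r \<in> {0..}"
    show "r\<^sup>2 * multiexp mul X v $ i = multiexp mul X (r *\<^sub>R v) $ i"
      using r i by (cases "r = 0") (simp_all add: multiexp_dilation mul0)
  qed simp
  have 2: "((\<lambda>r. r\<^sup>2 * multiexp mul X v $ i) has_vector_derivative 0) (at (0::real) within {0..})"
    unfolding has_real_derivative_iff_has_vector_derivative[symmetric]
    by (auto intro!: derivative_eq_intros)
  have "D\<Gamma> v $ i = 0"
    by (rule vector_derivative_unique_within[OF _ 1 2])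
      (simp add: trivial_limit_at_right_real at_within_Ici_at_right)
  then show False using v by simp
qed

text \<open>The integral curve of \<open>\<xi> \<cdot> X\<close> has length \<open>norm \<xi>\<close>, and its first layer cannot be reached on a shorter curve.\<close>

lemma sr_dist_Exp: "sr_dist X 0 (Exp \<xi>) = norm \<xi>"
proof (rule antisym)
  have "horizontally_joined X 0 (Exp \<xi>) (norm \<xi>)" using joined_foldr_Exp[of "[\<xi>]"] by simp
  then show "sr_dist X 0 (Exp \<xi>) \<le> norm \<xi>" "norm \<xi> \<le> sr_dist X 0 (Exp \<xi>)"
    using norm_horizontal_part_le_if_joined by (fastforce intro: sr_dist_le le_sr_dist)+
qed

text \<open>The differential is onto at \<open>(\<xi>, \<dots>, \<xi>)\<close>, where the multiexponential map takes the value
\<open>Exp (p \<xi>)\<close> and not \<open>Exp \<xi>\<close>. The dilation by \<open>p\<close> moves the target: the equation is solved for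
\<open>\<delta>\<^sub>p (Exp \<xi> \<cdot> y)\<close>, and the solution is divided by \<open>p\<close>.\<close>

lemma multiexp_covers_nbhd:
  fixes \<xi> :: "real^'m" and D\<Gamma> :: "real^'m^'p::{finite,linorder} \<Rightarrow> real^'n"
  assumes der: "(multiexp mul X has_derivative D\<Gamma>) (at (\<chi> i. \<xi>))" and "surj D\<Gamma>"
  obtains C e where "C > 0" "e > 0"
    "\<And>y. norm y < e \<Longrightarrow> \<exists>v :: real^'m^'p::{finite,linorder}. multiexp mul X (v /\<^sub>R real CARD('p)) = mul (Exp \<xi>) y \<and>
        norm (v - (\<chi> i. \<xi>)) \<le> C * norm y"
proof -
  let ?p = "real CARD('p)" and ?u0 = "(\<chi> i. \<xi>) :: real^'m^'p::{finite,linorder}"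
  define \<phi> where "\<phi> y = dilation w ?p (mul (Exp \<xi>) y)" for y
  have \<phi>0: "multiexp mul X ?u0 = \<phi> 0" by (simp add: \<phi>_def multiexp_diagonal Exp_dilation)
  obtain C\<^sub>1 e\<^sub>1 where C1: "C\<^sub>1 > 0" "e\<^sub>1 > 0" "\<And>z. norm (z - \<phi> 0) < e\<^sub>1 \<Longrightarrow>
      \<exists>v. multiexp mul X v = z \<and> norm (v - ?u0) \<le> C\<^sub>1 * norm (z - \<phi> 0)"
    using open_mapping_linear_bound[OF continuous_on_multiexp der \<open>surj D\<Gamma>\<close>] unfolding \<phi>0 by blast
  have "(\<phi> has_derivative (\<lambda>v. dilation w ?p (frechet_derivative (mul (Exp \<xi>)) (at 0) v))) (at 0)"
    unfolding \<phi>_def by (intro derivative_intros mul_left_has_derivative)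
  from has_derivative_imp_linear_bound[OF this]
  obtain K d where K: "K > 0" "d > 0" "\<And>y. norm y < d \<Longrightarrow> norm (\<phi> y - \<phi> 0) \<le> K * norm y"
    by auto
  show thesis
  proof (rule that[of "C\<^sub>1 * K" "min d (e\<^sub>1 / K)"])
    fix y :: "real^'n" assume y: "norm y < min d (e\<^sub>1 / K)"
    then have le: "norm (\<phi> y - \<phi> 0) \<le> K * norm y" using K(3) by simp
    also have "\<dots> < e\<^sub>1" using y K(1) by (simp add: pos_less_divide_eq mult.commute)
    finally obtain v where v: "multiexp mul X v = \<phi> y" "norm (v - ?u0) \<le> C\<^sub>1 * norm (\<phi> y - \<phi> 0)"
      using C1(3) by blast
    have "dilation w (inverse ?p) (\<phi> y) = mul (Exp \<xi>) y"
      by (simp add: \<phi>_def vec_eq_iff power_inverse)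
    then have "multiexp mul X (v /\<^sub>R ?p) = mul (Exp \<xi>) y"
      using v(1) by (simp add: multiexp_dilation)
    moreover have "norm (v - ?u0) \<le> C\<^sub>1 * K * norm y"
      using order_trans[OF v(2) mult_left_mono[OF le, of C\<^sub>1]] C1(1) by (simp add: mult.assoc)
    ultimately show "\<exists>v. multiexp mul X (v /\<^sub>R ?p) = mul (Exp \<xi>) y \<and> norm (v - ?u0) \<le> C\<^sub>1 * K * norm y"
      by blast
  qed (use C1 K in simp_all)
qed

text \<open>The first order terms of the summands add up to a multiple of the mean deviation of \<open>v\<close> from \<open>\<xi>\<close>.
The first layer of the equation for \<open>v\<close> identifies this mean as the first layer of \<open>y\<close>, with no
dependence on the individual \<open>v $ i\<close>.\<close>

lemma sum_norm_multiexp_le: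
  fixes v :: "real^'m^'p::{finite,linorder}"
  assumes "\<xi> \<noteq> 0"
    and \<Gamma>: "multiexp mul X (v /\<^sub>R real CARD('p)) = mul (Exp \<xi>) y"
    and close: "norm (v - (\<chi> i. \<xi>)) \<le> c"
  shows "(\<Sum>i\<in>UNIV. norm ((v /\<^sub>R real CARD('p)) $ i)) \<le> norm \<xi> + (\<xi> \<bullet> horizontal_part y) / norm \<xi> + c\<^sup>2 / (2 * norm \<xi>)"
proof -
  let ?p = "real CARD('p)"
  have p: "?p > 0" by simp
  define q where "q i = v $ i - \<xi>" for i
  have mean: "(\<Sum>i\<in>UNIV. v $ i) /\<^sub>R ?p = \<xi> + horizontal_part y"
    using arg_cong[OF \<Gamma>, of horizontal_part] by (simp add: horizontal_part_multiexp scaleR_sum_right)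
  have "(\<Sum>i\<in>UNIV. v $ i) = ?p *\<^sub>R ((\<Sum>i\<in>UNIV. v $ i) /\<^sub>R ?p)" by simp
  also have "\<dots> = ?p *\<^sub>R \<xi> + ?p *\<^sub>R horizontal_part y" by (simp only: mean scaleR_add_right)
  finally have sum_q: "(\<Sum>i\<in>UNIV. q i) = ?p *\<^sub>R horizontal_part y"
    by (simp add: q_def sum_subtractf sum_constant_scaleR del: sum_constant)
  have "norm (v $ i) \<le> norm \<xi> + (\<xi> \<bullet> q i) / norm \<xi> + c\<^sup>2 / (2 * norm \<xi>)" for i
  proof -
    have "norm (q i) \<le> norm (v - (\<chi> i. \<xi>))"
      using Finite_Cartesian_Product.norm_nth_le[of "v - (\<chi> i. \<xi>)" i] by (simp add: q_def)
    then have "(norm (q i))\<^sup>2 \<le> c\<^sup>2" using close by (intro power_mono) auto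
    then have "(norm (q i))\<^sup>2 / (2 * norm \<xi>) \<le> c\<^sup>2 / (2 * norm \<xi>)" by (intro divide_right_mono) auto
    then show ?thesis using norm_add_le_tangent[OF \<open>\<xi> \<noteq> 0\<close>, of "q i"] by (simp add: q_def)
  qed
  then have "(\<Sum>i\<in>UNIV. norm (v $ i)) \<le> (\<Sum>i\<in>UNIV. norm \<xi> + (\<xi> \<bullet> q i) / norm \<xi> + c\<^sup>2 / (2 * norm \<xi>))"
    by (rule sum_mono)
  also have "\<dots> = ?p * norm \<xi> + (\<xi> \<bullet> (\<Sum>i\<in>UNIV. q i)) / norm \<xi> + ?p * (c\<^sup>2 / (2 * norm \<xi>))"
    by (simp add: sum.distrib inner_sum_right sum_divide_distrib)
  also have "\<dots> = ?p * (norm \<xi> + (\<xi> \<bullet> horizontal_part y) / norm \<xi> + c\<^sup>2 / (2 * norm \<xi>))"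
    by (simp add: sum_q algebra_simps)
  finally have "(\<Sum>i\<in>UNIV. norm (v $ i)) / ?p \<le> norm \<xi> + (\<xi> \<bullet> horizontal_part y) / norm \<xi> + c\<^sup>2 / (2 * norm \<xi>)"
    using p by (simp add: pos_divide_le_eq mult.commute)
  moreover have "(\<Sum>i\<in>UNIV. norm ((v /\<^sub>R ?p) $ i)) = (\<Sum>i\<in>UNIV. norm (v $ i)) / ?p"
    by (simp add: sum_distrib_left divide_inverse mult.commute)
  ultimately show ?thesis by simp
qed

lemma sr_dist_pansu_differentiable:
  fixes \<xi> :: "real^'m" and D\<Gamma> :: "real^'m^'p::{finite,linorder} \<Rightarrow> real^'n"
  assumes "s \<ge> 2" and der: "(multiexp mul X has_derivative D\<Gamma>) (at (\<chi> i. \<xi>))" and "surj D\<Gamma>"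
  shows "pansu_differentiable mul w X (sr_dist X 0) (Exp \<xi>)"
proof -
  let ?f = "sr_dist X 0"
  define T where "T y = (\<xi> \<bullet> horizontal_part y) / norm \<xi>" for y
  have \<xi>: "\<xi> \<noteq> 0" by (rule nonzero_if_surj_derivative[OF assms])
  obtain C e where C: "C > 0" "e > 0"
    and cover: "\<And>y. norm y < e \<Longrightarrow> \<exists>v :: real^'m^'p::{finite,linorder}. multiexp mul X (v /\<^sub>R real CARD('p)) = mul (Exp \<xi>) y \<and>
        norm (v - (\<chi> i. \<xi>)) \<le> C * norm y"
    using multiexp_covers_nbhd[OF der \<open>surj D\<Gamma>\<close>] by metis
  obtain M where M: "M > 0" "\<And>y L. norm y \<le> 1 \<Longrightarrow> horizontally_joined X 0 y L \<Longrightarrow> norm y \<le> M * L"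
    using norm_le_if_joined_0 by metis
  define B where "B = C\<^sup>2 / (2 * norm \<xi>)"
  have bound: "norm ((?f (mul (Exp \<xi>) y) - ?f (Exp \<xi>) - T y) / ?f y) \<le> B * M * norm y"
    if y: "y \<noteq> 0" "norm y < e" "norm y \<le> 1" for y
  proof -
    obtain v :: "real^'m^'p::{finite,linorder}" where v: "multiexp mul X (v /\<^sub>R real CARD('p)) = mul (Exp \<xi>) y"
      "norm (v - (\<chi> i. \<xi>)) \<le> C * norm y" using cover[OF y(2)] by blast
    define L where "L = (\<Sum>i\<in>UNIV. norm ((v /\<^sub>R real CARD('p)) $ i))"
    have joined: "horizontally_joined X 0 (mul (Exp \<xi>) y) L"
      unfolding L_def v(1)[symmetric] by (rule joined_multiexp)
    have "L \<le> norm \<xi> + T y + B * (norm y)\<^sup>2"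
      using sum_norm_multiexp_le[OF \<xi> v] by (simp add: L_def T_def B_def power_mult_distrib)
    then have upper: "?f (mul (Exp \<xi>) y) \<le> norm \<xi> + T y + B * (norm y)\<^sup>2"
      using sr_dist_le[OF joined] by simp
    have lower: "norm \<xi> + T y \<le> ?f (mul (Exp \<xi>) y)"
    proof (rule le_sr_dist[OF joined])
      fix L assume "horizontally_joined X 0 (mul (Exp \<xi>) y) L"
      from norm_horizontal_part_le_if_joined[OF this] show "norm \<xi> + T y \<le> L"
        using norm_add_ge_tangent[OF \<xi>, of "horizontal_part y"] by (simp add: T_def)
    qed
    \<comment> \<open>The point \<open>y\<close> itself must also be joined to the origin: go to \<open>Exp (- \<xi>)\<close> first.\<close>
    have "y = mul (Exp (- \<xi>)) (multiexp mul X (v /\<^sub>R real CARD('p)))"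
      unfolding v(1) Exp_uminus by (simp add: assoc[symmetric])
    then obtain L' where "horizontally_joined X 0 y L'"
      using joined_foldr_Exp[of "- \<xi> # map (\<lambda>i. (v /\<^sub>R real CARD('p)) $ i) (sorted_list_of_set UNIV)"]
      by (auto simp: multiexp_def o_def)
    then have "norm y / M \<le> ?f y"
      using M y by (intro le_sr_dist) (auto simp: pos_divide_le_eq mult.commute)
    then have fy: "norm y \<le> M * ?f y" "?f y > 0"
      using M(1) y(1) by (auto simp: pos_divide_le_eq mult.commute intro: less_le_trans[of _ "norm y / M"])
    have "\<bar>?f (mul (Exp \<xi>) y) - ?f (Exp \<xi>) - T y\<bar> \<le> B * norm y * norm y"
      using upper lower by (simp add: sr_dist_Exp power2_eq_square mult.assoc)
    also have "\<dots> \<le> B * norm y * (M * ?f y)"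
      using fy C by (intro mult_left_mono) (auto simp: B_def)
    finally show ?thesis using fy(2) by (simp add: pos_divide_le_eq mult_ac)
  qed
  have "G_linear mul w T"
    unfolding G_linear_def by (simp add: T_def inner_add_right add_divide_distrib)
  moreover have "((\<lambda>y. (?f (mul (Exp \<xi>) y) - ?f (Exp \<xi>) - T y) / ?f y) \<longlongrightarrow> 0) (at 0)"
  proof (rule Lim_null_comparison)
    show "\<forall>\<^sub>F y in at 0. norm ((?f (mul (Exp \<xi>) y) - ?f (Exp \<xi>) - T y) / ?f y) \<le> B * M * norm y"
      unfolding eventually_at using C(2) bound by (intro exI[of _ "min e 1"]) auto
    have "((\<lambda>y. B * M * norm y) \<longlongrightarrow> B * M * norm (0 :: real^'n)) (at (0 :: real^'n))"
      by (intro tendsto_intros)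
    then show "((\<lambda>y. B * M * norm y) \<longlongrightarrow> 0) (at (0 :: real^'n))" by simp
  qed
  ultimately show ?thesis unfolding pansu_differentiable_def by blast
qed

end

theorem theorem1p4:
  fixes mul :: "real^'n \<Rightarrow> real^'n \<Rightarrow> real^'n"
    and inv :: "real^'n \<Rightarrow> real^'n"
    and s :: nat
    and w :: "'n \<Rightarrow> nat"
    and h :: "'m::finite \<Rightarrow> 'n"
    and X :: "'m \<Rightarrow> real^'n \<Rightarrow> real^'n"
    and \<xi> :: "real^'m"
    and D\<Gamma> :: "real^'m^'p::{finite,linorder} \<Rightarrow> real^'n"
  assumes "carnot_group mul inv s w h X"
    and "s \<ge> 2"
    and "(multiexp mul X has_derivative D\<Gamma>) (at (\<chi> i. \<xi>))"
    and "surj D\<Gamma>"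
  shows "pansu_differentiable mul w X (sr_dist X 0) (lie_exp (horizontal_comb X \<xi>))"
  using carnot_group.sr_dist_pansu_differentiable[OF assms] .

end
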